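(* For each $n$, let $y\sim\mathrm N_n(\mu_0,\sigma_0^2I_n)$ with $\mu_0=\mu_{0,n}\in\mathbb R^n$ and $\sigma_0=\sigma_{0,n}>0$, where $\sigma_0^2>n^{-B}$ for some constant $B>0$. Let the prior make $\mu\in\mathbb R^n$ and $\sigma^2$ independent, where the prior of $\sigma^2$ (not depending on $n$) has a density $g$ on $(0,\infty)$ that is $L$-Lipschitz on $(0,\infty)$ and satisfies $\Pi\{\sigma^2>t\}=O(t^{-1})$ as $t\to\infty$. Let $\epsilon_n>0$ satisfy $\epsilon_n/\sigma_0\to0$ and $n\epsilon_n^2/\sigma_0^2\ge\log n$, and suppose $g(\sigma_0^2)\ge 2L\sigma_0\epsilon_n$. Suppose there exist sets $\mathcal M_n\subset\mathbb R^n$ and constants $\bar C>0$, $\bar D>0$, $\bar E>0$ such that for all $n$ $$\Pi\{\lVert\mu-\mu_0\rVert_2^2\le n\epsilon_n^2\}\ge e^{-\bar Cn\epsilon_n^2/\sigma_0^2},\quad N(\sqrt n\,\epsilon_n,\mathcal M_n,\lVert\cdot\rVert_2)\le e^{\bar Dn\epsilon_n^2/\sigma_0^2},\quad \Pi\{\mu\notin\mathcal M_n\}\le e^{-\bar En\epsilon_n^2/\sigma_0^2}.$$ Then, provided $\bar E$ is sufficiently large (relative to $\bar C$ and $B$), there exists a constant $M>0$ such that $$\mathbb E_{\mu_0,\sigma_0}\Pi\{(\mu,\sigma):d((\mu,\sigma),(\mu_0,\sigma_0))\ge M\epsilon_n\mid y\}\to0\quad(n\to\infty).$$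
   Context: The posterior $\Pi(\cdot\mid y)$ is computed under the likelihood $y\mid(\mu,\sigma)\sim\mathrm N_n(\mu,\sigma^2I_n)$; $\mathbb E_{\mu,\sigma}$ is the expectation under $\mathrm N_n(\mu,\sigma^2I_n)$. The metric $d$ on $\mathbb R^n\times(0,\infty)$ is $d^2((\mu_1,\sigma_1),(\mu_2,\sigma_2))=n^{-1}\lVert\mu_1-\mu_2\rVert_2^2+|\sigma_1-\sigma_2|^2$. $N(\epsilon,\mathcal E,\rho)$ denotes the $\epsilon$-covering number of $\mathcal E$ with respect to $\rho$. *)

theory Defs
  imports "HOL-Probability.Probability" "HOL-Library.Landau_Symbols"
begin

text \<open>Vectors in R^n are represented as functions nat => real; only coordinates i < n matter.\<close>

definition l2norm_sq :: "nat \<Rightarrow> (nat \<Rightarrow> real) \<Rightarrow> real" where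
  "l2norm_sq n x = (\<Sum>i<n. (x i)\<^sup>2)"

definition l2dist :: "nat \<Rightarrow> (nat \<Rightarrow> real) \<Rightarrow> (nat \<Rightarrow> real) \<Rightarrow> real" where
  "l2dist n x y = sqrt (\<Sum>i<n. (x i - y i)\<^sup>2)"

definition dpar :: "nat \<Rightarrow> (nat \<Rightarrow> real) \<times> real \<Rightarrow> (nat \<Rightarrow> real) \<times> real \<Rightarrow> real" where
  "dpar n p q = sqrt (inverse (real n) * (\<Sum>i<n. (fst p i - fst q i)\<^sup>2) + \<bar>snd p - snd q\<bar>\<^sup>2)"

text \<open>Covering number N(eps, A, rho): least cardinality of a finite set of centres whose
  closed rho-balls of radius eps cover A (infinity if no finite cover exists).\<close>
definition covering_number :: "('a \<Rightarrow> 'a \<Rightarrow> real) \<Rightarrow> real \<Rightarrow> 'a set \<Rightarrow> ennreal" where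
  "covering_number \<rho> eps A =
     (INF F \<in> {F. finite F \<and> A \<subseteq> (\<Union>c\<in>F. {x. \<rho> c x \<le> eps})}. of_nat (card F))"

definition gauss_lik :: "nat \<Rightarrow> (nat \<Rightarrow> real) \<Rightarrow> (nat \<Rightarrow> real) \<Rightarrow> real \<Rightarrow> real" where
  "gauss_lik n y mu sd = (\<Prod>i<n. normal_density (mu i) sd (y i))"

definition gauss_measure :: "nat \<Rightarrow> (nat \<Rightarrow> real) \<Rightarrow> real \<Rightarrow> (nat \<Rightarrow> real) measure" where
  "gauss_measure n mu sd = PiM {..<n} (\<lambda>i. density lborel (\<lambda>x. ennreal (normal_density (mu i) sd x)))"

text \<open>Prior on (mu, sigma^2): product of the prior of mu and the law with density g on (0,inf).\<close>
definition joint_prior :: "(nat \<Rightarrow> real) measure \<Rightarrow> (real \<Rightarrow> real) \<Rightarrow> ((nat \<Rightarrow> real) \<times> real) measure" where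
  "joint_prior P g = P \<Otimes>\<^sub>M density lborel (\<lambda>s. ennreal (indicator {0<..} s * g s))"

text \<open>Posterior probability (Bayes formula) of the event {(mu,sigma) : Q mu sigma} given y,
  for a prior on (mu, sigma^2), under the likelihood N_n(mu, sigma^2 I_n).\<close>
definition posterior_prob ::
  "nat \<Rightarrow> ((nat \<Rightarrow> real) \<times> real) measure \<Rightarrow> ((nat \<Rightarrow> real) \<Rightarrow> real \<Rightarrow> bool) \<Rightarrow> (nat \<Rightarrow> real) \<Rightarrow> real" where
  "posterior_prob n P Q y =
     (\<integral>\<theta>. (if Q (fst \<theta>) (sqrt (snd \<theta>)) then 1 else 0) * gauss_lik n y (fst \<theta>) (sqrt (snd \<theta>)) \<partial>P) /
     (\<integral>\<theta>. gauss_lik n y (fst \<theta>) (sqrt (snd \<theta>)) \<partial>P)"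

end

theory Submission
  imports Defs
begin

text \<open>With \<open>H = n * \<epsilon>\<^sup>2 / \<sigma>\<^sub>0\<^sup>2\<close>, three estimates are combined. First, the
  evidence is at least \<open>exp (- (Cbar + 2 * B + 7 / 2) * H)\<close> times a constant outside an event of
  probability \<open>exp (- H)\<close>: near \<open>(\<mu>\<^sub>0, \<sigma>\<^sub>0)\<close> with
  \<open>\<sigma> \<ge> \<sigma>\<^sub>0\<close> the chi-square type integral of the inverse likelihood ratio is at most
  \<open>exp (3 / 2 * H)\<close>, and the Lipschitz density \<open>g\<close> gives prior mass of order
  \<open>\<sigma>\<^sub>0\<^sup>2 * \<epsilon>\<^sup>2\<close> to this one-sided neighbourhood of \<open>\<sigma>\<^sub>0\<^sup>2\<close>. Second, explicit tests based on
  \<open>\<parallel>y - \<mu>\<^sub>0\<parallel>\<^sup>2\<close> and on the linear statistics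
  \<open>\<langle>y - \<mu>\<^sub>0, c - \<mu>\<^sub>0\<rangle>\<close> for the covering centres \<open>c\<close> have
  errors \<open>exp (- E * H)\<close> uniformly in all \<open>\<sigma> > 0\<close>, which makes a sieve for
  \<open>\<sigma>\<close> superfluous. Third, the prior mass outside the sieve is
  \<open>exp (- Ebar * H)\<close>. Every Gaussian tail bound is a Chernoff bound derived from one formula for
  the integral of the exponential of a quadratic polynomial.\<close>

subsection \<open>Gaussian integrals of exponential quadratics\<close>

text \<open>Let \<open>\<delta> = eps / sigma0\<close>, which tends to 0. In units of
  \<open>sigma0^2\<close>, a change of \<open>sigma\<close> by \<open>K * eps\<close> moves the
  expected squared distance of \<open>y\<close> from \<open>mu0\<close> at first order in
  \<open>\<delta>\<close>, whereas a mean at distance of order \<open>sqrt n * eps\<close> moves it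
  only at second order. So the squared distance decides about \<open>sigma\<close> although the mean
  is unknown, once the linear statistics have excluded distant means. The constants are fixed in the
  order \<open>E\<close>, \<open>K\<close>, \<open>M1\<close>, \<open>M\<close>; only
  \<open>M1\<close> has to beat the covering number, so the lower bound on \<open>Ebar\<close> does
  not involve \<open>Dbar\<close>. The neighbourhood of \<open>sigma0\<close> is one-sided because
  the integral of the inverse likelihood ratio is governed by the weight
  \<open>2 - sigma0^2 / sigma^2\<close>, which is at least 1 for \<open>sigma \<ge> sigma0\<close>,
  while for \<open>sigma^2 \<le> sigma0^2 / 2\<close> it is not positive and the integral is
  infinite. Finally \<open>H \<ge> ln n\<close> turns the polynomial lower bounds on
  \<open>sigma0\<close> and \<open>eps\<close> into exponentials in \<open>H\<close>; this is where
  \<open>2 * B\<close> comes from.\<close>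

text \<open>Completing the square: the tilted density is a constant times the normal density with
  mean \<open>m'\<close> and variance \<open>sd^2 / w\<close>, which integrates to 1. Positivity of
  \<open>w\<close> is exactly what keeps this variance positive.\<close>

lemma nn_integral_normal_density_exp_quadratic:
  fixes a b c m sd :: real
  assumes sd: "sd > 0" and w: "1 - 2 * a * sd\<^sup>2 > 0"
  shows "(\<integral>\<^sup>+x. ennreal (exp (a * (x - c)\<^sup>2 + b * (x - c))) \<partial>density lborel (\<lambda>x. ennreal (normal_density m sd x)))
    = ennreal (1 / sqrt (1 - 2 * a * sd\<^sup>2) *
        exp ((a * (m - c)\<^sup>2 + b * (m - c) + b\<^sup>2 * sd\<^sup>2 / 2) / (1 - 2 * a * sd\<^sup>2)))"
proof -
  define w where "w = 1 - 2 * a * sd\<^sup>2"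
  define sd' where "sd' = sd / sqrt w"
  define d where "d = m - c"
  define m' where "m' = c + (d + b * sd\<^sup>2) / w"
  have w0: "w > 0" using w by (simp add: w_def)
  have sd'0: "sd' > 0" using sd w0 by (simp add: sd'_def)
  have sd'2: "sd'\<^sup>2 = sd\<^sup>2 / w" using w0 by (simp add: sd'_def power_divide)
  \<comment> \<open>Eliminating \<open>a\<close> in favour of \<open>w\<close> makes
    \<open>w\<close> an atom known to be nonzero when \<open>field_simps\<close> clears denominators
    in \<open>quad\<close>.\<close>
  have a: "a = (1 - w) / (2 * sd\<^sup>2)" using sd by (simp add: w_def)
  define k where "k = 1 / sqrt w * exp ((a * d\<^sup>2 + b * d + b\<^sup>2 * sd\<^sup>2 / 2) / w)"
  have k0: "k \<ge> 0" using w0 by (simp add: k_def)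
  have quad: "a * (x - c)\<^sup>2 + b * (x - c) + - (x - m)\<^sup>2 / (2 * sd\<^sup>2)
      = (a * d\<^sup>2 + b * d + b\<^sup>2 * sd\<^sup>2 / 2) / w + - (x - m')\<^sup>2 / (2 * sd'\<^sup>2)" for x
  proof -
    define z where "z = x - c"
    have x: "x - c = z" "x - m = z - d" "x - m' = z - (d + b * sd\<^sup>2) / w"
      by (simp_all add: z_def d_def m'_def)
    define v where "v = sd\<^sup>2"
    have v: "v > 0" using sd by (simp add: v_def)
    show ?thesis unfolding x sd'2 a v_def[symmetric]
      using v w0 by (simp add: field_simps power2_eq_square)
  qed
  have norm: "1 / sqrt (2 * pi * sd\<^sup>2) = 1 / sqrt w * (1 / sqrt (2 * pi * sd'\<^sup>2))"
    using w0 sd by (simp add: sd'2 real_sqrt_mult real_sqrt_divide)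
  have eq: "normal_density m sd x * exp (a * (x - c)\<^sup>2 + b * (x - c)) = k * normal_density m' sd' x" for x
  proof -
    have "normal_density m sd x * exp (a * (x - c)\<^sup>2 + b * (x - c))
      = 1 / sqrt (2 * pi * sd\<^sup>2) * exp (a * (x - c)\<^sup>2 + b * (x - c) + - (x - m)\<^sup>2 / (2 * sd\<^sup>2))"
      by (simp only: normal_density_def exp_add mult_ac)
    also have "\<dots> = k * normal_density m' sd' x"
      unfolding quad norm k_def normal_density_def exp_add by (simp only: mult_ac)
    finally show ?thesis .
  qed
  have "(\<integral>\<^sup>+x. ennreal (exp (a * (x - c)\<^sup>2 + b * (x - c))) \<partial>density lborel (\<lambda>x. ennreal (normal_density m sd x)))
    = (\<integral>\<^sup>+x. ennreal k * ennreal (normal_density m' sd' x) \<partial>lborel)"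
    using k0 by (subst nn_integral_density) (auto simp: ennreal_mult[symmetric] eq)
  also have "\<dots> = ennreal k * (\<integral>\<^sup>+x. ennreal (normal_density m' sd' x) \<partial>lborel)"
    by (rule nn_integral_cmult) auto
  also have "(\<integral>\<^sup>+x. ennreal (normal_density m' sd' x) \<partial>lborel) = 1"
    using prob_space.emeasure_space_1[OF prob_space_normal_density[OF sd'0, of m']]
    by (simp add: emeasure_density)
  finally show ?thesis by (simp add: k_def w_def d_def)
qed

section \<open>Gaussian laws on R^n\<close>

lemma prob_space_gauss_measure: "sd > 0 \<Longrightarrow> prob_space (gauss_measure n mu sd)"
  unfolding gauss_measure_def by (intro prob_space_PiM prob_space_normal_density)

lemma sets_gauss_measure [measurable_cong]:
  "sets (gauss_measure n mu sd) = sets (PiM {..<n} (\<lambda>_. lborel))"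
  unfolding gauss_measure_def by (intro sets_PiM_cong) auto

lemma product_sigma_finite_normal:
  "sd > 0 \<Longrightarrow> product_sigma_finite (\<lambda>i::nat. density lborel (\<lambda>x. ennreal (normal_density (mu i) sd x)))"
  by (intro product_sigma_finite.intro prob_space_imp_sigma_finite prob_space_normal_density)

text \<open>Bayes' formula with \<open>gauss_lik\<close> presupposes one dominating measure for all
  parameters. A product measure is determined by its values on boxes, and there both sides
  factor.\<close>

lemma gauss_measure_density:
  assumes sd: "sd > 0"
  shows "gauss_measure n mu sd = density (PiM {..<n} (\<lambda>_. lborel)) (\<lambda>y. ennreal (gauss_lik n y mu sd))"
  unfolding gauss_measure_def
proof (rule product_sigma_finite.PiM_eqI[OF product_sigma_finite_normal[OF sd], symmetric])
  interpret L: product_sigma_finite "\<lambda>_::nat. lborel :: real measure"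
    by standard
  show "finite {..<n}" by simp
  fix A :: "nat \<Rightarrow> real set"
  assume "\<And>i. i \<in> {..<n} \<Longrightarrow> A i \<in> sets (density lborel (\<lambda>x. ennreal (normal_density (mu i) sd x)))"
  then have A [measurable]: "i < n \<Longrightarrow> A i \<in> sets borel" for i by auto
  have m [measurable]: "Pi\<^sub>E {..<n} A \<in> sets (PiM {..<n} (\<lambda>_. lborel))"
    by (rule sets_PiM_I_finite) auto
  have lm: "(\<lambda>y. ennreal (gauss_lik n y mu sd)) \<in> borel_measurable (PiM {..<n} (\<lambda>_. lborel))"
    unfolding gauss_lik_def by measurable
  have "emeasure (density (PiM {..<n} (\<lambda>_. lborel)) (\<lambda>y. ennreal (gauss_lik n y mu sd))) (Pi\<^sub>E {..<n} A)
    = (\<integral>\<^sup>+y. ennreal (gauss_lik n y mu sd) * indicator (Pi\<^sub>E {..<n} A) y \<partial>PiM {..<n} (\<lambda>_. lborel))"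
    by (rule emeasure_density[OF lm m])
  also have "\<dots> = (\<integral>\<^sup>+y. (\<Prod>i<n. ennreal (normal_density (mu i) sd (y i)) * indicator (A i) (y i)) \<partial>PiM {..<n} (\<lambda>_. lborel))"
  proof (rule nn_integral_cong)
    fix y :: "nat \<Rightarrow> real" assume y: "y \<in> space (PiM {..<n} (\<lambda>_. lborel))"
    have "indicator (Pi\<^sub>E {..<n} A) y = (\<Prod>i<n. indicator (A i) (y i) :: ennreal)"
    proof (cases "\<forall>i<n. y i \<in> A i")
      case True
      then have "y \<in> Pi\<^sub>E {..<n} A" using y by (auto simp: space_PiM PiE_iff)
      then show ?thesis using True by simp
    next
      case False
      then have "y \<notin> Pi\<^sub>E {..<n} A" by (auto simp: PiE_iff)
      moreover have "(\<Prod>i<n. indicator (A i) (y i) :: ennreal) = 0"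
        using False by (intro prod_zero) (auto simp: indicator_def)
      ultimately show ?thesis by simp
    qed
    then show "ennreal (gauss_lik n y mu sd) * indicator (Pi\<^sub>E {..<n} A) y
      = (\<Prod>i<n. ennreal (normal_density (mu i) sd (y i)) * indicator (A i) (y i))"
      by (simp add: gauss_lik_def prod_ennreal prod.distrib)
  qed
  also have "\<dots> = (\<Prod>i<n. \<integral>\<^sup>+x. ennreal (normal_density (mu i) sd x) * indicator (A i) x \<partial>lborel)"
    by (rule L.product_nn_integral_prod) auto
  also have "\<dots> = (\<Prod>i<n. emeasure (density lborel (\<lambda>x. ennreal (normal_density (mu i) sd x))) (A i))"
    by (intro prod.cong refl) (subst emeasure_density, auto)
  finally show "emeasure (density (PiM {..<n} (\<lambda>_. lborel)) (\<lambda>y. ennreal (gauss_lik n y mu sd))) (Pi\<^sub>E {..<n} A)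
    = (\<Prod>i<n. emeasure (density lborel (\<lambda>x. ennreal (normal_density (mu i) sd x))) (A i))" .
qed (auto intro!: sets_PiM_cong)

text \<open>One \<open>a\<close> shared by all coordinates, with coordinatewise \<open>b\<close> and
  \<open>c\<close>, covers every later use: \<open>b = 0\<close> for the squared distance,
  \<open>a = 0\<close> for linear statistics, both terms for the likelihood ratio.\<close>

lemma nn_integral_gauss_measure_exp_quadratic:
  fixes a sd :: real and b c mu :: "nat \<Rightarrow> real"
  assumes sd: "sd > 0" and w: "1 - 2 * a * sd\<^sup>2 > 0"
  shows "(\<integral>\<^sup>+y. ennreal (exp (\<Sum>i<n. a * (y i - c i)\<^sup>2 + b i * (y i - c i))) \<partial>gauss_measure n mu sd)
    = ennreal ((1 / sqrt (1 - 2 * a * sd\<^sup>2)) ^ n *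
        exp ((\<Sum>i<n. a * (mu i - c i)\<^sup>2 + b i * (mu i - c i) + (b i)\<^sup>2 * sd\<^sup>2 / 2) / (1 - 2 * a * sd\<^sup>2)))"
proof -
  interpret G: product_sigma_finite "\<lambda>i::nat. density lborel (\<lambda>x. ennreal (normal_density (mu i) sd x))"
    by (rule product_sigma_finite_normal[OF sd])
  have "(\<integral>\<^sup>+y. ennreal (exp (\<Sum>i<n. a * (y i - c i)\<^sup>2 + b i * (y i - c i))) \<partial>gauss_measure n mu sd)
    = (\<integral>\<^sup>+y. (\<Prod>i<n. ennreal (exp (a * (y i - c i)\<^sup>2 + b i * (y i - c i)))) \<partial>gauss_measure n mu sd)"
    by (simp add: exp_sum prod_ennreal)
  also have "\<dots> = (\<Prod>i<n. \<integral>\<^sup>+x. ennreal (exp (a * (x - c i)\<^sup>2 + b i * (x - c i)))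
      \<partial>density lborel (\<lambda>x. ennreal (normal_density (mu i) sd x)))"
    unfolding gauss_measure_def by (rule G.product_nn_integral_prod) auto
  also have "\<dots> = (\<Prod>i<n. ennreal (1 / sqrt (1 - 2 * a * sd\<^sup>2) *
        exp ((a * (mu i - c i)\<^sup>2 + b i * (mu i - c i) + (b i)\<^sup>2 * sd\<^sup>2 / 2) / (1 - 2 * a * sd\<^sup>2))))"
    by (simp only: nn_integral_normal_density_exp_quadratic[OF sd w])
  also have "\<dots> = ennreal (\<Prod>i<n. 1 / sqrt (1 - 2 * a * sd\<^sup>2) *
        exp ((a * (mu i - c i)\<^sup>2 + b i * (mu i - c i) + (b i)\<^sup>2 * sd\<^sup>2 / 2) / (1 - 2 * a * sd\<^sup>2)))"
    using w by (intro prod_ennreal) auto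
  finally show ?thesis
    by (simp add: prod.distrib exp_sum[symmetric] sum_divide_distrib power_one_over prod_dividef)
qed

subsection \<open>Bayes' formula, tests and evidence\<close>

text \<open>Read \<open>d\<close> as the evidence, \<open>a\<close> as the true density and
  \<open>n\<close> as the evidence restricted to an event: where the evidence is at least
  \<open>c * a\<close>, Bayes' denominator can be traded for the constant \<open>c\<close>. The case
  \<open>d = \<top>\<close> is trivial since division by \<open>\<top>\<close> gives 0.\<close>

lemma ennreal_ratio_mult_le:
  fixes c a n d :: ennreal
  assumes c: "0 < c" "c < \<top>" and a: "a < \<top>" and le: "c * a \<le> d"
  shows "n / d * a \<le> n / c"
proof (cases "d = \<top>")
  case True
  then show ?thesis by simp
next
  case False
  show ?thesis
  proof (cases "a = 0")
    case False
    have d0: "d > 0"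
      using le c False by (metis ennreal_zero_less_mult_iff gr_zeroI le_zero_eq less_le_trans)
    have "n / d * a = n * (a / d)"
      by (simp add: divide_ennreal_def mult_ac)
    also have "a / d \<le> 1 / c"
    proof -
      obtain a' where a': "a = ennreal a'" "a' \<ge> 0" using a by (cases a) auto
      obtain c' where c': "c = ennreal c'" "c' > 0" using c by (cases c) auto
      obtain d' where d': "d = ennreal d'" "d' > 0" using d0 \<open>d \<noteq> \<top>\<close> by (cases d) auto
      have "c' * a' \<le> d'" using le a' c' d' by (simp add: ennreal_mult[symmetric])
      then have "a' / d' \<le> 1 / c'" using c' d' by (simp add: field_simps)
      then show ?thesis using a' c' d'
        by (simp add: divide_ennreal flip: ennreal_1)
    qed
    finally show ?thesis
      by (simp add: divide_ennreal_def mult_left_mono)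
  qed simp
qed

text \<open>The classical testing argument. On the rejection region \<open>R\<close> and where the
  evidence is too small, the posterior mass is bounded by 1. Elsewhere the denominator cancels the
  true density up to the factor \<open>c\<close>, and Fubini turns the numerator into the prior
  average of the type II errors.\<close>

lemma nn_integral_posterior_le:
  fixes p :: "'a \<Rightarrow> 'b \<Rightarrow> ennreal" and c :: ennreal
  assumes "sigma_finite_measure P" "sigma_finite_measure N"
  assumes p: "(\<lambda>(\<theta>, y). p \<theta> y) \<in> borel_measurable (P \<Otimes>\<^sub>M N)"
    and p0 [measurable]: "p0 \<in> borel_measurable N" and p0_fin: "\<And>y. y \<in> space N \<Longrightarrow> p0 y < \<top>"
    and U [measurable]: "U \<in> sets P" and R [measurable]: "R \<in> sets N" and c: "0 < c" "c < \<top>"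
  shows "(\<integral>\<^sup>+y. (\<integral>\<^sup>+\<theta>. indicator U \<theta> * p \<theta> y \<partial>P) / (\<integral>\<^sup>+\<theta>. p \<theta> y \<partial>P) \<partial>density N p0)
    \<le> emeasure (density N p0) R
      + emeasure (density N p0) {y\<in>space N. (\<integral>\<^sup>+\<theta>. p \<theta> y \<partial>P) < c * p0 y}
      + (\<integral>\<^sup>+\<theta>. indicator U \<theta> * emeasure (density N (p \<theta>)) (space N - R) \<partial>P) / c"
proof -
  interpret P: sigma_finite_measure P by fact
  interpret N: sigma_finite_measure N by fact
  interpret PN: pair_sigma_finite P N ..
  interpret NP: pair_sigma_finite N P ..
  have p' [measurable]: "(\<lambda>(y, \<theta>). p \<theta> y) \<in> borel_measurable (N \<Otimes>\<^sub>M P)"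
    using measurable_comp[OF measurable_pair_swap' p] by (simp add: comp_def case_prod_beta')
  note p [measurable]
  have ps: "p \<theta> \<in> borel_measurable N" if "\<theta> \<in> space P" for \<theta>
    using measurable_Pair2[OF p that] by simp
  define num where "num y = (\<integral>\<^sup>+\<theta>. indicator U \<theta> * p \<theta> y \<partial>P)" for y
  define den where "den y = (\<integral>\<^sup>+\<theta>. p \<theta> y \<partial>P)" for y
  have num [measurable]: "num \<in> borel_measurable N"
    unfolding num_def by (rule P.borel_measurable_nn_integral) measurable
  have den [measurable]: "den \<in> borel_measurable N"
    unfolding den_def by (rule P.borel_measurable_nn_integral) measurable
  let ?bad = "{y\<in>space N. den y < c * p0 y}"
  have num_den: "num y \<le> den y" for y
    unfolding num_def den_def by (intro nn_integral_mono) (auto simp: indicator_def)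
  \<comment> \<open>If \<open>den y\<close> is 0, then so is \<open>num y\<close>, and
    \<open>0 / 0 = 0\<close> in \<open>ennreal\<close>; division by \<open>\<top>\<close> gives 0 as
    well.\<close>
  have ratio1: "num y / den y \<le> 1" for y
    using divide_right_mono_ennreal[OF num_den[of y], of "den y"] num_den[of y]
    by (cases "den y = 0 \<or> den y = \<top>") (auto simp: ennreal_divide_self less_top)
  have pt: "p0 y * (num y / den y) \<le> p0 y * indicator R y + p0 y * indicator ?bad y
      + (num y * indicator (space N - R) y) / c" if y: "y \<in> space N" for y
  proof (cases "y \<in> R \<or> y \<in> ?bad")
    case True
    have "p0 y * (num y / den y) \<le> p0 y * 1" by (intro mult_left_mono ratio1) simp
    also have "\<dots> \<le> p0 y * indicator R y + p0 y * indicator ?bad y"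
      using True by (auto simp: indicator_def)
    finally show ?thesis by (simp add: add_increasing2)
  next
    case False
    then have "c * p0 y \<le> den y" using y by auto
    from ennreal_ratio_mult_le[OF c p0_fin[OF y] this, of "num y"]
    show ?thesis using False y by (auto simp: mult.commute)
  qed
  have "(\<integral>\<^sup>+y. num y / den y \<partial>density N p0) = (\<integral>\<^sup>+y. p0 y * (num y / den y) \<partial>N)"
    by (rule nn_integral_density) measurable
  also have "\<dots> \<le> (\<integral>\<^sup>+y. p0 y * indicator R y + p0 y * indicator ?bad y
      + (num y * indicator (space N - R) y) / c \<partial>N)"
    by (intro nn_integral_mono pt)
  also have "\<dots> = (\<integral>\<^sup>+y. p0 y * indicator R y \<partial>N) + (\<integral>\<^sup>+y. p0 y * indicator ?bad y \<partial>N)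
      + (\<integral>\<^sup>+y. (num y * indicator (space N - R) y) / c \<partial>N)"
    by (simp add: nn_integral_add)
  also have "(\<integral>\<^sup>+y. p0 y * indicator R y \<partial>N) = emeasure (density N p0) R"
    by (simp add: emeasure_density)
  also have "(\<integral>\<^sup>+y. p0 y * indicator ?bad y \<partial>N) = emeasure (density N p0) ?bad"
    by (subst emeasure_density) measurable
  also have "(\<integral>\<^sup>+y. (num y * indicator (space N - R) y) / c \<partial>N)
      = (\<integral>\<^sup>+y. num y * indicator (space N - R) y \<partial>N) / c"
    by (rule nn_integral_divide) measurable
  also have "(\<integral>\<^sup>+y. num y * indicator (space N - R) y \<partial>N)
      = (\<integral>\<^sup>+y. (\<integral>\<^sup>+\<theta>. indicator U \<theta> * p \<theta> y * indicator (space N - R) y \<partial>P) \<partial>N)"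
    unfolding num_def
    by (intro nn_integral_cong nn_integral_multc[symmetric]) measurable
  also have "\<dots> = (\<integral>\<^sup>+\<theta>. (\<integral>\<^sup>+y. indicator U \<theta> * p \<theta> y * indicator (space N - R) y \<partial>N) \<partial>P)"
    by (rule PN.Fubini') measurable
  also have "\<dots> = (\<integral>\<^sup>+\<theta>. indicator U \<theta> * emeasure (density N (p \<theta>)) (space N - R) \<partial>P)"
  proof (rule nn_integral_cong)
    fix \<theta> assume \<theta>: "\<theta> \<in> space P"
    note [measurable] = ps[OF \<theta>]
    show "(\<integral>\<^sup>+y. indicator U \<theta> * p \<theta> y * indicator (space N - R) y \<partial>N)
      = indicator U \<theta> * emeasure (density N (p \<theta>)) (space N - R)"
      by (simp add: emeasure_density nn_integral_cmult mult.assoc)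
  qed
  finally show ?thesis by (simp add: num_def den_def)
qed

text \<open>The evidence is bounded from below through the pointwise inequality
  \<open>r + t\<^sup>2 / r \<ge> 2 * t\<close> for the likelihood ratio \<open>r\<close>, so that only
  the chi-square type integral of \<open>1 / r\<close> has to be controlled.\<close>

lemma emeasure_evidence_less:
  fixes p :: "'a \<Rightarrow> 'b \<Rightarrow> real" and p0 :: "'b \<Rightarrow> real" and t X :: real
  assumes "sigma_finite_measure P" "sigma_finite_measure N"
  assumes p: "(\<lambda>(\<theta>, y). p \<theta> y) \<in> borel_measurable (P \<Otimes>\<^sub>M N)"
    and p0 [measurable]: "p0 \<in> borel_measurable N"
    and p0_pos: "\<And>y. y \<in> space N \<Longrightarrow> p0 y > 0"
    and A [measurable]: "A \<in> sets P" and PA: "emeasure P A = ennreal m" "m > 0"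
    and p_pos: "\<And>\<theta> y. \<theta> \<in> A \<Longrightarrow> y \<in> space N \<Longrightarrow> p \<theta> y > 0"
    and X: "\<And>\<theta>. \<theta> \<in> A \<Longrightarrow> (\<integral>\<^sup>+y. ennreal (p0 y / p \<theta> y) \<partial>density N (\<lambda>y. ennreal (p0 y))) \<le> ennreal X"
    and t: "t > 0" and X0: "X \<ge> 0"
  shows "emeasure (density N (\<lambda>y. ennreal (p0 y)))
      {y\<in>space N. (\<integral>\<^sup>+\<theta>. ennreal (p \<theta> y) \<partial>P) < ennreal (t * m) * ennreal (p0 y)} \<le> ennreal (t * X)"
proof -
  interpret P: sigma_finite_measure P by fact
  interpret N: sigma_finite_measure N by fact
  interpret PN: pair_sigma_finite P N ..
  have p' [measurable]: "(\<lambda>(y, \<theta>). p \<theta> y) \<in> borel_measurable (N \<Otimes>\<^sub>M P)"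
    using measurable_comp[OF measurable_pair_swap' p] by (simp add: comp_def case_prod_beta')
  note p [measurable]
  have ps: "p \<theta> \<in> borel_measurable N" if "\<theta> \<in> space P" for \<theta>
    using measurable_Pair2[OF p that] by simp
  have ps': "(\<lambda>\<theta>. p \<theta> y) \<in> borel_measurable P" if "y \<in> space N" for y
    using measurable_Pair1[OF p that] by simp
  define G where "G y = (\<integral>\<^sup>+\<theta>. indicator A \<theta> * ennreal (p0 y / p \<theta> y) \<partial>P)" for y
  have G [measurable]: "G \<in> borel_measurable N"
    unfolding G_def by (rule P.borel_measurable_nn_integral) measurable
  let ?bad = "{y\<in>space N. (\<integral>\<^sup>+\<theta>. ennreal (p \<theta> y) \<partial>P) < ennreal (t * m) * ennreal (p0 y)}"
  \<comment> \<open>If \<open>t * G y < m\<close>, then integrating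
    \<open>2 * t \<le> r + t^2 / r\<close> over \<open>A\<close> gives
    \<open>2 * t * m \<le> Rt + t * m\<close>, so \<open>Rt \<ge> t * m\<close> and the evidence is
    large. The bad event therefore lies in \<open>{t * G \<ge> m}\<close>, and Markov's inequality
    for \<open>G\<close> finishes the proof.\<close>
  have bad: "ennreal m \<le> ennreal t * G y" if y: "y \<in> ?bad" for y
  proof (rule ccontr)
    assume "\<not> ennreal m \<le> ennreal t * G y"
    then have lt: "ennreal t * G y < ennreal m" by simp
    have yN: "y \<in> space N" using y by simp
    note [measurable] = ps'[OF yN]
    define Rt where "Rt = (\<integral>\<^sup>+\<theta>. indicator A \<theta> * ennreal (p \<theta> y / p0 y) \<partial>P)"
    have "ennreal (2 * t) * ennreal m = (\<integral>\<^sup>+\<theta>. ennreal (2 * t) * indicator A \<theta> \<partial>P)"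
      by (simp add: nn_integral_cmult_indicator PA)
    also have "\<dots> \<le> (\<integral>\<^sup>+\<theta>. indicator A \<theta> * ennreal (p \<theta> y / p0 y)
        + ennreal (t\<^sup>2) * (indicator A \<theta> * ennreal (p0 y / p \<theta> y)) \<partial>P)"
    proof (rule nn_integral_mono)
      fix \<theta>
      show "ennreal (2 * t) * indicator A \<theta> \<le> indicator A \<theta> * ennreal (p \<theta> y / p0 y)
        + ennreal (t\<^sup>2) * (indicator A \<theta> * ennreal (p0 y / p \<theta> y))"
      proof (cases "\<theta> \<in> A")
        case True
        define r where "r = p \<theta> y / p0 y"
        have r: "r > 0" using p_pos[OF True yN] p0_pos[OF yN] by (simp add: r_def)
        have r': "p0 y / p \<theta> y = 1 / r" by (simp add: r_def)
        have "0 \<le> (r - t)\<^sup>2 / r" using r by simp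
        also have "\<dots> = r + t\<^sup>2 * (1 / r) - 2 * t"
          using r by (simp add: field_simps power2_eq_square)
        finally have "2 * t \<le> r + t\<^sup>2 * (1 / r)" by simp
        then have "ennreal (2 * t) \<le> ennreal r + ennreal (t\<^sup>2) * ennreal (1 / r)"
          using r t by (simp add: ennreal_mult[symmetric] ennreal_plus[symmetric] del: ennreal_plus)
        then show ?thesis using True by (simp add: r_def[symmetric] r')
      qed simp
    qed
    also have "\<dots> = Rt + ennreal (t\<^sup>2) * G y"
      by (simp add: Rt_def G_def nn_integral_add nn_integral_cmult)
    also have "ennreal (t\<^sup>2) * G y = ennreal t * (ennreal t * G y)"
      using t by (simp add: power2_eq_square ennreal_mult mult.assoc)
    finally have le: "ennreal (2 * t) * ennreal m \<le> Rt + ennreal t * (ennreal t * G y)" .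
    \<comment> \<open>Cancelling \<open>t * m\<close> is legitimate only between finite quantities;
      assuming the contrary makes \<open>Rt\<close> finite, and the cancellation then happens in the
      reals.\<close>
    have "ennreal (t * m) \<le> Rt"
    proof (rule ccontr)
      assume nle: "\<not> ?thesis"
      have tG: "ennreal t * (ennreal t * G y) \<le> ennreal (t * m)"
        using lt t PA(2) by (simp add: ennreal_mult mult_left_mono)
      have "Rt < ennreal (t * m)" using nle by simp
      then obtain r where r: "Rt = ennreal r" "0 \<le> r" "r < t * m"
        using t PA(2) by (cases Rt) (auto simp: ennreal_less_iff)
      have "ennreal (2 * t * m) \<le> Rt + ennreal t * (ennreal t * G y)"
        using le t PA(2) by (simp add: ennreal_mult)
      also have "\<dots> \<le> ennreal r + ennreal (t * m)"
        unfolding r(1) by (intro add_left_mono tG)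
      also have "\<dots> = ennreal (r + t * m)"
        using r t PA(2) by (simp add: ennreal_plus[symmetric] del: ennreal_plus)
      finally have "2 * t * m \<le> r + t * m"
        using r t PA(2) by (subst (asm) ennreal_le_iff) auto
      then show False using r(3) by linarith
    qed
    then have "ennreal (t * m) * ennreal (p0 y) \<le> Rt * ennreal (p0 y)"
      by (intro mult_right_mono) auto
    also have "\<dots> = (\<integral>\<^sup>+\<theta>. indicator A \<theta> * ennreal (p \<theta> y / p0 y) * ennreal (p0 y) \<partial>P)"
      unfolding Rt_def by (rule nn_integral_multc[symmetric]) measurable
    also have "\<dots> \<le> (\<integral>\<^sup>+\<theta>. ennreal (p \<theta> y) \<partial>P)"
    proof (rule nn_integral_mono)
      fix \<theta>
      show "indicator A \<theta> * ennreal (p \<theta> y / p0 y) * ennreal (p0 y) \<le> ennreal (p \<theta> y)"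
      proof (cases "\<theta> \<in> A")
        case True
        then show ?thesis using p_pos[OF True yN] p0_pos[OF yN]
          by (simp add: ennreal_mult[symmetric])
      qed simp
    qed
    finally show False using y by (auto simp: not_le[symmetric])
  qed
  have badm [measurable]: "?bad \<in> sets N" by measurable
  have GX: "(\<integral>\<^sup>+y. G y \<partial>density N (\<lambda>y. ennreal (p0 y))) \<le> ennreal X * ennreal m"
  proof -
    have "(\<integral>\<^sup>+y. G y \<partial>density N (\<lambda>y. ennreal (p0 y))) = (\<integral>\<^sup>+y. ennreal (p0 y) * G y \<partial>N)"
      by (rule nn_integral_density) measurable
    also have "\<dots> = (\<integral>\<^sup>+y. (\<integral>\<^sup>+\<theta>. ennreal (p0 y) * (indicator A \<theta> * ennreal (p0 y / p \<theta> y)) \<partial>P) \<partial>N)"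
      unfolding G_def by (intro nn_integral_cong nn_integral_cmult[symmetric]) measurable
    also have "\<dots> = (\<integral>\<^sup>+\<theta>. (\<integral>\<^sup>+y. ennreal (p0 y) * (indicator A \<theta> * ennreal (p0 y / p \<theta> y)) \<partial>N) \<partial>P)"
      by (rule PN.Fubini') measurable
    also have "\<dots> \<le> (\<integral>\<^sup>+\<theta>. ennreal X * indicator A \<theta> \<partial>P)"
    proof (rule nn_integral_mono)
      fix \<theta> assume \<theta>: "\<theta> \<in> space P"
      note [measurable] = ps[OF \<theta>]
      have "(\<integral>\<^sup>+y. ennreal (p0 y) * (indicator A \<theta> * ennreal (p0 y / p \<theta> y)) \<partial>N)
        = (\<integral>\<^sup>+y. indicator A \<theta> * (ennreal (p0 y) * ennreal (p0 y / p \<theta> y)) \<partial>N)"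
        by (simp add: mult_ac)
      also have "\<dots> = indicator A \<theta> * (\<integral>\<^sup>+y. ennreal (p0 y) * ennreal (p0 y / p \<theta> y) \<partial>N)"
        by (rule nn_integral_cmult) measurable
      also have "(\<integral>\<^sup>+y. ennreal (p0 y) * ennreal (p0 y / p \<theta> y) \<partial>N)
        = (\<integral>\<^sup>+y. ennreal (p0 y / p \<theta> y) \<partial>density N (\<lambda>y. ennreal (p0 y)))"
        by (rule nn_integral_density[symmetric]) measurable
      finally show "(\<integral>\<^sup>+y. ennreal (p0 y) * (indicator A \<theta> * ennreal (p0 y / p \<theta> y)) \<partial>N)
        \<le> ennreal X * indicator A \<theta>"
        using X[of \<theta>] by (cases "\<theta> \<in> A") auto
    qed
    also have "\<dots> = ennreal X * ennreal m"
      by (simp add: nn_integral_cmult_indicator PA)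
    finally show ?thesis .
  qed
  have "ennreal m * emeasure (density N (\<lambda>y. ennreal (p0 y))) ?bad
    = (\<integral>\<^sup>+y. ennreal m * indicator ?bad y \<partial>density N (\<lambda>y. ennreal (p0 y)))"
    by (rule nn_integral_cmult_indicator[symmetric]) simp
  also have "\<dots> \<le> (\<integral>\<^sup>+y. ennreal t * G y \<partial>density N (\<lambda>y. ennreal (p0 y)))"
  proof (rule nn_integral_mono)
    fix y show "ennreal m * indicator ?bad y \<le> ennreal t * G y"
      using bad[of y] by (cases "y \<in> ?bad") auto
  qed
  also have "\<dots> = ennreal t * (\<integral>\<^sup>+y. G y \<partial>density N (\<lambda>y. ennreal (p0 y)))"
    by (rule nn_integral_cmult) measurable
  also have "\<dots> \<le> ennreal t * (ennreal X * ennreal m)"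
    by (intro mult_left_mono GX) simp
  also have "\<dots> = ennreal m * ennreal (t * X)"
    using t X0 PA(2) by (simp add: ennreal_mult mult_ac)
  finally show ?thesis
    using PA(2) by (simp add: ennreal_mult_le_mult_iff)
qed

subsection \<open>Gaussian Chernoff bounds\<close>

text \<open>Markov's inequality for the exponential of a quadratic that is nonnegative on
  \<open>A\<close>; the determinant factor enters the exponent as \<open>- n / 2 * ln w\<close>. In
  the applications below \<open>k\<close> is minus the tilted threshold.\<close>

lemma gauss_chernoff:
  fixes a sd k e :: real and b c mu :: "nat \<Rightarrow> real"
  assumes sd: "sd > 0" and w: "1 - 2 * a * sd\<^sup>2 > 0"
    and A: "\<And>y. y \<in> A \<Longrightarrow> 0 \<le> k + (\<Sum>i<n. a * (y i - c i)\<^sup>2 + b i * (y i - c i))"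
    and e: "k - real n / 2 * ln (1 - 2 * a * sd\<^sup>2) +
      (\<Sum>i<n. a * (mu i - c i)\<^sup>2 + b i * (mu i - c i) + (b i)\<^sup>2 * sd\<^sup>2 / 2) / (1 - 2 * a * sd\<^sup>2) \<le> e"
  shows "emeasure (gauss_measure n mu sd) A \<le> ennreal (exp e)"
\<comment> \<open>A set outside the sigma-algebra has \<open>emeasure\<close> 0; this case is closed
  at the end.\<close>
proof (cases "A \<in> sets (gauss_measure n mu sd)")
  case True
  let ?w = "1 - 2 * a * sd\<^sup>2"
  have "emeasure (gauss_measure n mu sd) A = (\<integral>\<^sup>+y. indicator A y \<partial>gauss_measure n mu sd)"
    using True by simp
  also have "\<dots> \<le> (\<integral>\<^sup>+y. ennreal (exp k) * ennreal (exp (\<Sum>i<n. a * (y i - c i)\<^sup>2 + b i * (y i - c i))) \<partial>gauss_measure n mu sd)"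
  proof (rule nn_integral_mono)
    fix y
    show "indicator A y \<le> ennreal (exp k) * ennreal (exp (\<Sum>i<n. a * (y i - c i)\<^sup>2 + b i * (y i - c i)))"
    proof (cases "y \<in> A")
      case True
      then have "1 \<le> exp (k + (\<Sum>i<n. a * (y i - c i)\<^sup>2 + b i * (y i - c i)))"
        using A by simp
      then show ?thesis using True by (simp add: ennreal_mult[symmetric] exp_add)
    qed simp
  qed
  also have "\<dots> = ennreal (exp k) * (\<integral>\<^sup>+y. ennreal (exp (\<Sum>i<n. a * (y i - c i)\<^sup>2 + b i * (y i - c i))) \<partial>gauss_measure n mu sd)"
    by (rule nn_integral_cmult) measurable
  also have "\<dots> = ennreal (exp k * ((1 / sqrt ?w) ^ n *
        exp ((\<Sum>i<n. a * (mu i - c i)\<^sup>2 + b i * (mu i - c i) + (b i)\<^sup>2 * sd\<^sup>2 / 2) / ?w)))"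
    using w by (simp add: nn_integral_gauss_measure_exp_quadratic[OF sd w] ennreal_mult[symmetric])
  also have "(1 / sqrt ?w) ^ n = exp (- (real n / 2 * ln ?w))"
  proof -
    have "1 / sqrt ?w = exp (- (ln ?w / 2))"
      using w by (simp add: exp_minus ln_sqrt[symmetric] inverse_eq_divide)
    then have "(1 / sqrt ?w) ^ n = exp (real n * - (ln ?w / 2))"
      by (simp only: exp_of_nat_mult)
    then show ?thesis by (simp add: mult.commute)
  qed
  also have "exp k * (exp (- (real n / 2 * ln ?w)) *
        exp ((\<Sum>i<n. a * (mu i - c i)\<^sup>2 + b i * (mu i - c i) + (b i)\<^sup>2 * sd\<^sup>2 / 2) / ?w))
      = exp (k - real n / 2 * ln ?w +
        (\<Sum>i<n. a * (mu i - c i)\<^sup>2 + b i * (mu i - c i) + (b i)\<^sup>2 * sd\<^sup>2 / 2) / ?w)"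
    by (simp only: diff_conv_add_uminus exp_add mult.assoc)
  also have "ennreal \<dots> \<le> ennreal (exp e)"
    using e by (intro ennreal_leI) simp
  finally show ?thesis .
qed (simp add: emeasure_notin_sets)

lemma sum_quadratic_eq_l2norm_sq:
  "(\<Sum>i<n. a * (y i - c i)\<^sup>2 + 0 * (y i - c i)) = a * l2norm_sq n (\<lambda>i. y i - c i)"
  by (simp add: l2norm_sq_def sum_distrib_left)

section \<open>Tails of the squared distance from mu0\<close>

text \<open>With \<open>x = 2 * a * sd0^2\<close>, the bound
  \<open>ln (1 - x) \<ge> - x - 2 * x^2\<close> leaves
  \<open>n / 2 * (2 * x^2 - x * \<kappa>)\<close> as exponent. The chosen tilt
  \<open>x = \<kappa> / 4\<close> is its minimiser.\<close>

lemma gauss_sq_upper: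
  fixes sd0 \<kappa> :: real
  assumes sd0: "sd0 > 0" and \<kappa>: "0 < \<kappa>" "\<kappa> \<le> 1"
  shows "emeasure (gauss_measure n mu0 sd0)
      {y \<in> space (gauss_measure n mu0 sd0). l2norm_sq n (\<lambda>i. y i - mu0 i) > real n * sd0\<^sup>2 * (1 + \<kappa>)}
    \<le> ennreal (exp (- (real n * \<kappa>\<^sup>2 / 16)))"
proof (rule gauss_chernoff[where a = "\<kappa> / (8 * sd0\<^sup>2)" and b = "\<lambda>_. 0" and c = mu0
      and k = "- (real n * \<kappa> * (1 + \<kappa>) / 8)"])
  have w: "1 - 2 * (\<kappa> / (8 * sd0\<^sup>2)) * sd0\<^sup>2 = 1 - \<kappa> / 4"
    using sd0 by simp
  show "1 - 2 * (\<kappa> / (8 * sd0\<^sup>2)) * sd0\<^sup>2 > 0" unfolding w using \<kappa> by simp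
  have ln: "- (\<kappa> / 4) - 2 * (\<kappa> / 4)\<^sup>2 \<le> ln (1 - \<kappa> / 4)"
    by (rule ln_one_minus_pos_lower_bound) (use \<kappa> in auto)
  have "- (real n * \<kappa> * (1 + \<kappa>) / 8) - real n / 2 * ln (1 - \<kappa> / 4)
      = real n / 2 * (- (\<kappa> * (1 + \<kappa>) / 4) - ln (1 - \<kappa> / 4))"
    by (simp add: algebra_simps)
  also have "\<dots> \<le> real n / 2 * (- (\<kappa> * (1 + \<kappa>) / 4) + \<kappa> / 4 + 2 * (\<kappa> / 4)\<^sup>2)"
    using ln by (intro mult_left_mono) auto
  also have "\<dots> = - (real n * \<kappa>\<^sup>2 / 16)"
    by (simp add: field_simps power2_eq_square)
  finally show "- (real n * \<kappa> * (1 + \<kappa>) / 8) - real n / 2 * ln (1 - 2 * (\<kappa> / (8 * sd0\<^sup>2)) * sd0\<^sup>2) +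
      (\<Sum>i<n. \<kappa> / (8 * sd0\<^sup>2) * (mu0 i - mu0 i)\<^sup>2 + 0 * (mu0 i - mu0 i) + 0\<^sup>2 * sd0\<^sup>2 / 2) /
      (1 - 2 * (\<kappa> / (8 * sd0\<^sup>2)) * sd0\<^sup>2) \<le> - (real n * \<kappa>\<^sup>2 / 16)"
    unfolding w by simp
next
  fix y assume "y \<in> {y \<in> space (gauss_measure n mu0 sd0). l2norm_sq n (\<lambda>i. y i - mu0 i) > real n * sd0\<^sup>2 * (1 + \<kappa>)}"
  then have "real n * sd0\<^sup>2 * (1 + \<kappa>) \<le> l2norm_sq n (\<lambda>i. y i - mu0 i)" by simp
  then have "\<kappa> / (8 * sd0\<^sup>2) * (real n * sd0\<^sup>2 * (1 + \<kappa>)) \<le> \<kappa> / (8 * sd0\<^sup>2) * l2norm_sq n (\<lambda>i. y i - mu0 i)"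
    using \<kappa> by (intro mult_left_mono) auto
  then show "0 \<le> - (real n * \<kappa> * (1 + \<kappa>) / 8) +
      (\<Sum>i<n. \<kappa> / (8 * sd0\<^sup>2) * (y i - mu0 i)\<^sup>2 + 0 * (y i - mu0 i))"
    unfolding sum_quadratic_eq_l2norm_sq using sd0 by (simp add: mult_ac)
qed (use assms in auto)

text \<open>Now \<open>w = 1 + x\<close> and \<open>ln (1 + x) \<ge> x - x^2\<close> leaves
  \<open>n / 2 * (x^2 - x * \<kappa>)\<close>, minimised at \<open>x = \<kappa> / 2\<close>.\<close>

lemma gauss_sq_lower:
  fixes sd0 \<kappa> :: real
  assumes sd0: "sd0 > 0" and \<kappa>: "0 < \<kappa>" "\<kappa> \<le> 1"
  shows "emeasure (gauss_measure n mu0 sd0)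
      {y \<in> space (gauss_measure n mu0 sd0). l2norm_sq n (\<lambda>i. y i - mu0 i) < real n * sd0\<^sup>2 * (1 - \<kappa>)}
    \<le> ennreal (exp (- (real n * \<kappa>\<^sup>2 / 8)))"
proof (rule gauss_chernoff[where a = "- (\<kappa> / (4 * sd0\<^sup>2))" and b = "\<lambda>_. 0" and c = mu0
      and k = "real n * \<kappa> * (1 - \<kappa>) / 4"])
  have w: "1 - 2 * - (\<kappa> / (4 * sd0\<^sup>2)) * sd0\<^sup>2 = 1 + \<kappa> / 2"
    using sd0 by simp
  show "1 - 2 * - (\<kappa> / (4 * sd0\<^sup>2)) * sd0\<^sup>2 > 0" unfolding w using \<kappa> by simp
  have ln: "\<kappa> / 2 - (\<kappa> / 2)\<^sup>2 \<le> ln (1 + \<kappa> / 2)"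
    by (rule ln_one_plus_pos_lower_bound) (use \<kappa> in auto)
  have "real n * \<kappa> * (1 - \<kappa>) / 4 - real n / 2 * ln (1 + \<kappa> / 2)
      = real n / 2 * (\<kappa> * (1 - \<kappa>) / 2 - ln (1 + \<kappa> / 2))"
    by (simp add: algebra_simps)
  also have "\<dots> \<le> real n / 2 * (\<kappa> * (1 - \<kappa>) / 2 - \<kappa> / 2 + (\<kappa> / 2)\<^sup>2)"
    using ln by (intro mult_left_mono) auto
  also have "\<dots> = - (real n * \<kappa>\<^sup>2 / 8)"
    by (simp add: field_simps power2_eq_square)
  finally show "real n * \<kappa> * (1 - \<kappa>) / 4 - real n / 2 * ln (1 - 2 * - (\<kappa> / (4 * sd0\<^sup>2)) * sd0\<^sup>2) +
      (\<Sum>i<n. - (\<kappa> / (4 * sd0\<^sup>2)) * (mu0 i - mu0 i)\<^sup>2 + 0 * (mu0 i - mu0 i) + 0\<^sup>2 * sd0\<^sup>2 / 2) /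
      (1 - 2 * - (\<kappa> / (4 * sd0\<^sup>2)) * sd0\<^sup>2) \<le> - (real n * \<kappa>\<^sup>2 / 8)"
    unfolding w by simp
next
  fix y assume "y \<in> {y \<in> space (gauss_measure n mu0 sd0). l2norm_sq n (\<lambda>i. y i - mu0 i) < real n * sd0\<^sup>2 * (1 - \<kappa>)}"
  then have "l2norm_sq n (\<lambda>i. y i - mu0 i) \<le> real n * sd0\<^sup>2 * (1 - \<kappa>)" by simp
  then have "\<kappa> / (4 * sd0\<^sup>2) * l2norm_sq n (\<lambda>i. y i - mu0 i) \<le> \<kappa> / (4 * sd0\<^sup>2) * (real n * sd0\<^sup>2 * (1 - \<kappa>))"
    using \<kappa> by (intro mult_left_mono) auto
  then show "0 \<le> real n * \<kappa> * (1 - \<kappa>) / 4 +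
      (\<Sum>i<n. - (\<kappa> / (4 * sd0\<^sup>2)) * (y i - mu0 i)\<^sup>2 + 0 * (y i - mu0 i))"
    unfolding sum_quadratic_eq_l2norm_sq using sd0 by (simp add: mult_ac)
qed (use assms in auto)

text \<open>The tilt is negative, so a displacement of the mean only lowers the exponent, and a
  larger \<open>sd\<close> only raises \<open>w\<close>. Hence one bound serves every
  \<open>mu\<close> and arbitrarily large \<open>sd\<close>.\<close>

lemma gauss_sq_overdispersed:
  fixes sd sd0 \<kappa> :: real
  assumes sd0: "sd0 > 0" and \<kappa>: "0 < \<kappa>" "\<kappa> \<le> 1 / 2" and sd: "sd \<ge> sd0 * (1 + \<kappa>)"
  shows "emeasure (gauss_measure n mu sd)
      {y \<in> space (gauss_measure n mu sd). l2norm_sq n (\<lambda>i. y i - mu0 i) \<le> real n * sd0\<^sup>2 * (1 + \<kappa>)}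
    \<le> ennreal (exp (- (real n * \<kappa>\<^sup>2 / 32)))"
proof (rule gauss_chernoff[where a = "- (\<kappa> / (16 * sd0\<^sup>2))" and b = "\<lambda>_. 0" and c = mu0
      and k = "real n * \<kappa> * (1 + \<kappa>) / 16"])
  define w where "w = 1 - 2 * - (\<kappa> / (16 * sd0\<^sup>2)) * sd\<^sup>2"
  \<comment> \<open>The variance ratio is at least \<open>1 + 2 * \<kappa>\<close>, the threshold
    only \<open>1 + \<kappa>\<close>. \<open>v\<close> is the part of \<open>w - 1\<close>
    guaranteed by the former; its excess over the threshold term makes the exponent
    negative.\<close>
  define v where "v = \<kappa> / 8 * (1 + 2 * \<kappa>)"
  have "1 + 2 * \<kappa> \<le> (1 + \<kappa>)\<^sup>2" by (simp add: power2_eq_square algebra_simps)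
  also have "\<dots> \<le> (sd / sd0)\<^sup>2"
    using sd sd0 \<kappa> by (intro power_mono) (auto simp: field_simps)
  finally have r: "1 + 2 * \<kappa> \<le> (sd / sd0)\<^sup>2" .
  have "w = 1 + \<kappa> / 8 * (sd / sd0)\<^sup>2"
    using sd0 by (simp add: w_def power_divide)
  also have "\<dots> \<ge> 1 + v"
    unfolding v_def using r \<kappa> by (intro add_left_mono mult_left_mono) auto
  finally have wv: "1 + v \<le> w" .
  have v: "0 < v" "v \<le> \<kappa> / 4" using \<kappa> by (auto simp: v_def)
  have w0: "w > 0" using wv v by simp
  then show "1 - 2 * - (\<kappa> / (16 * sd0\<^sup>2)) * sd\<^sup>2 > 0" by (simp add: w_def)
  have "v - v\<^sup>2 \<le> ln (1 + v)"
    by (rule ln_one_plus_pos_lower_bound) (use v \<kappa> in auto)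
  also have "\<dots> \<le> ln w" using wv v by simp
  finally have ln: "v - v\<^sup>2 \<le> ln w" .
  have v2: "v\<^sup>2 \<le> (\<kappa> / 4)\<^sup>2" using v by (intro power_mono) auto
  have "real n * \<kappa> * (1 + \<kappa>) / 16 - real n / 2 * ln w + (\<Sum>i<n. - (\<kappa> / (16 * sd0\<^sup>2)) * (mu i - mu0 i)\<^sup>2) / w
     \<le> real n * \<kappa> * (1 + \<kappa>) / 16 - real n / 2 * ln w + 0"
    using w0 \<kappa> by (intro add_left_mono divide_nonpos_pos sum_nonpos) auto
  also have "\<dots> = real n / 2 * (\<kappa> * (1 + \<kappa>) / 8 - ln w)"
    by (simp add: algebra_simps)
  also have "\<dots> \<le> real n / 2 * (\<kappa> * (1 + \<kappa>) / 8 - v + (\<kappa> / 4)\<^sup>2)"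
    using ln v2 by (intro mult_left_mono) auto
  also have "\<dots> = - (real n * \<kappa>\<^sup>2 / 32)"
    by (simp add: v_def field_simps power2_eq_square)
  finally show "real n * \<kappa> * (1 + \<kappa>) / 16 - real n / 2 * ln (1 - 2 * - (\<kappa> / (16 * sd0\<^sup>2)) * sd\<^sup>2) +
      (\<Sum>i<n. - (\<kappa> / (16 * sd0\<^sup>2)) * (mu i - mu0 i)\<^sup>2 + 0 * (mu i - mu0 i) + 0\<^sup>2 * sd\<^sup>2 / 2) /
      (1 - 2 * - (\<kappa> / (16 * sd0\<^sup>2)) * sd\<^sup>2) \<le> - (real n * \<kappa>\<^sup>2 / 32)"
    unfolding w_def[symmetric] by simp
next
  fix y assume "y \<in> {y \<in> space (gauss_measure n mu sd). l2norm_sq n (\<lambda>i. y i - mu0 i) \<le> real n * sd0\<^sup>2 * (1 + \<kappa>)}"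
  then have "l2norm_sq n (\<lambda>i. y i - mu0 i) \<le> real n * sd0\<^sup>2 * (1 + \<kappa>)" by simp
  then have "\<kappa> / (16 * sd0\<^sup>2) * l2norm_sq n (\<lambda>i. y i - mu0 i) \<le> \<kappa> / (16 * sd0\<^sup>2) * (real n * sd0\<^sup>2 * (1 + \<kappa>))"
    using \<kappa> by (intro mult_left_mono) auto
  then show "0 \<le> real n * \<kappa> * (1 + \<kappa>) / 16 +
      (\<Sum>i<n. - (\<kappa> / (16 * sd0\<^sup>2)) * (y i - mu0 i)\<^sup>2 + 0 * (y i - mu0 i))"
    unfolding sum_quadratic_eq_l2norm_sq using sd0 by (simp add: mult_ac)
next
  have "sd0 * (1 + \<kappa>) > 0" using sd0 \<kappa> by simp
  then show "sd > 0" using sd by linarith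
qed

text \<open>Here the tilt is positive and a displaced mean works against the bound, which is why its
  squared size must be at most of order \<open>\<kappa>\<close>. The variance ratio is at most
  \<open>(1 - \<kappa>)^2\<close>, a factor \<open>1 - \<kappa>\<close> below the threshold.\<close>

lemma gauss_sq_underdispersed:
  fixes sd sd0 \<kappa> :: real
  assumes sd0: "sd0 > 0" and \<kappa>: "0 < \<kappa>" "\<kappa> \<le> 1 / 2" and sd: "0 < sd" "sd \<le> sd0 * (1 - \<kappa>)"
    and mu: "l2norm_sq n (\<lambda>i. mu i - mu0 i) \<le> real n * sd0\<^sup>2 * (\<kappa> / 16)"
  shows "emeasure (gauss_measure n mu sd)
      {y \<in> space (gauss_measure n mu sd). l2norm_sq n (\<lambda>i. y i - mu0 i) \<ge> real n * sd0\<^sup>2 * (1 - \<kappa>)}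
    \<le> ennreal (exp (- (real n * \<kappa>\<^sup>2 / 128)))"
proof (rule gauss_chernoff[where a = "\<kappa> / (16 * sd0\<^sup>2)" and b = "\<lambda>_. 0" and c = mu0
      and k = "- (real n * \<kappa> * (1 - \<kappa>) / 16)"])
  define w where "w = 1 - 2 * (\<kappa> / (16 * sd0\<^sup>2)) * sd\<^sup>2"
  define x where "x = \<kappa> / 8"
  define v where "v = x * (1 - \<kappa>)\<^sup>2"
  have r: "(sd / sd0)\<^sup>2 \<le> (1 - \<kappa>)\<^sup>2"
    using sd sd0 by (intro power_mono) (auto simp: field_simps)
  have q: "(1 - \<kappa>)\<^sup>2 \<le> 1\<^sup>2" using \<kappa> by (intro power_mono) auto
  have x: "0 < x" "x \<le> 1 / 8" using \<kappa> by (auto simp: x_def)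
  have vx: "v \<le> x" unfolding v_def using x q by (intro mult_left_le) auto
  have v0: "0 \<le> v" using x by (simp add: v_def)
  have "w = 1 - x * (sd / sd0)\<^sup>2"
    using sd0 by (simp add: w_def x_def power_divide)
  also have "\<dots> \<ge> 1 - v"
    unfolding v_def using r x by (intro diff_left_mono mult_left_mono) auto
  finally have wv: "1 - v \<le> w" .
  have w0: "w \<ge> 1 / 2" using wv vx x by simp
  then show "1 - 2 * (\<kappa> / (16 * sd0\<^sup>2)) * sd\<^sup>2 > 0" by (simp add: w_def)
  have "- v - 2 * v\<^sup>2 \<le> ln (1 - v)"
    by (rule ln_one_minus_pos_lower_bound) (use v0 vx x in auto)
  also have "\<dots> \<le> ln w" using wv vx x by simp
  finally have ln: "- v - 2 * v\<^sup>2 \<le> ln w" .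
  have v2: "v\<^sup>2 \<le> x\<^sup>2" using vx v0 by (intro power_mono) auto
  have "(\<Sum>i<n. \<kappa> / (16 * sd0\<^sup>2) * (mu i - mu0 i)\<^sup>2) = \<kappa> / (16 * sd0\<^sup>2) * l2norm_sq n (\<lambda>i. mu i - mu0 i)"
    by (simp add: l2norm_sq_def sum_distrib_left)
  also have "\<dots> \<le> \<kappa> / (16 * sd0\<^sup>2) * (real n * sd0\<^sup>2 * (\<kappa> / 16))"
    using \<kappa> by (intro mult_left_mono mu) auto
  also have "\<dots> = real n * \<kappa>\<^sup>2 / 256"
    using sd0 by (simp add: field_simps power2_eq_square)
  finally have "(\<Sum>i<n. \<kappa> / (16 * sd0\<^sup>2) * (mu i - mu0 i)\<^sup>2) / w \<le> (real n * \<kappa>\<^sup>2 / 256) / (1 / 2)"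
    using w0 by (intro frac_le) auto
  then have "- (real n * \<kappa> * (1 - \<kappa>) / 16) - real n / 2 * ln w + (\<Sum>i<n. \<kappa> / (16 * sd0\<^sup>2) * (mu i - mu0 i)\<^sup>2) / w
     \<le> - (real n * \<kappa> * (1 - \<kappa>) / 16) - real n / 2 * ln w + real n * \<kappa>\<^sup>2 / 128"
    by simp
  also have "\<dots> = real n / 2 * (- (x * (1 - \<kappa>)) - ln w + \<kappa>\<^sup>2 / 64)"
    by (simp add: algebra_simps x_def)
  also have "\<dots> \<le> real n / 2 * (- (x * (1 - \<kappa>)) + v + 2 * x\<^sup>2 + \<kappa>\<^sup>2 / 64)"
    using ln v2 by (intro mult_left_mono) auto
  also have "- (x * (1 - \<kappa>)) + v = - (x * \<kappa> * (1 - \<kappa>))"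
    by (simp add: v_def power2_eq_square algebra_simps)
  also have "real n / 2 * (- (x * \<kappa> * (1 - \<kappa>)) + 2 * x\<^sup>2 + \<kappa>\<^sup>2 / 64)
     \<le> real n / 2 * (- (x * \<kappa> * (1 / 2)) + 2 * x\<^sup>2 + \<kappa>\<^sup>2 / 64)"
    using x \<kappa> by (intro mult_left_mono add_right_mono le_imp_neg_le) auto
  \<comment> \<open>The gap between variance and threshold contributes
    \<open>- \<kappa>^2 / 16\<close>; the remainder of the logarithm takes back
    \<open>\<kappa>^2 / 32\<close> and the mean \<open>\<kappa>^2 / 64\<close>, which leaves
    \<open>- \<kappa>^2 / 64\<close>.\<close>
  also have "\<dots> = - (real n * \<kappa>\<^sup>2 / 128)"
    by (simp add: x_def field_simps power2_eq_square)
  finally show "- (real n * \<kappa> * (1 - \<kappa>) / 16) - real n / 2 * ln (1 - 2 * (\<kappa> / (16 * sd0\<^sup>2)) * sd\<^sup>2) +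
      (\<Sum>i<n. \<kappa> / (16 * sd0\<^sup>2) * (mu i - mu0 i)\<^sup>2 + 0 * (mu i - mu0 i) + 0\<^sup>2 * sd\<^sup>2 / 2) /
      (1 - 2 * (\<kappa> / (16 * sd0\<^sup>2)) * sd\<^sup>2) \<le> - (real n * \<kappa>\<^sup>2 / 128)"
    unfolding w_def[symmetric] by simp
next
  fix y assume "y \<in> {y \<in> space (gauss_measure n mu sd). l2norm_sq n (\<lambda>i. y i - mu0 i) \<ge> real n * sd0\<^sup>2 * (1 - \<kappa>)}"
  then have "real n * sd0\<^sup>2 * (1 - \<kappa>) \<le> l2norm_sq n (\<lambda>i. y i - mu0 i)" by simp
  then have "\<kappa> / (16 * sd0\<^sup>2) * (real n * sd0\<^sup>2 * (1 - \<kappa>)) \<le> \<kappa> / (16 * sd0\<^sup>2) * l2norm_sq n (\<lambda>i. y i - mu0 i)"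
    using \<kappa> by (intro mult_left_mono) auto
  then show "0 \<le> - (real n * \<kappa> * (1 - \<kappa>) / 16) +
      (\<Sum>i<n. \<kappa> / (16 * sd0\<^sup>2) * (y i - mu0 i)\<^sup>2 + 0 * (y i - mu0 i))"
    unfolding sum_quadratic_eq_l2norm_sq using sd0 by (simp add: mult_ac)
qed (use assms in auto)

section \<open>Tails of the linear statistics\<close>

text \<open>Under the null the statistic is centred with variance
  \<open>sd0^2 * l2norm_sq n v\<close>. The tilt \<open>1 / (2 * sd0^2)\<close> is threshold over
  variance, the optimal choice for a Gaussian variable.\<close>

lemma gauss_linear_null:
  fixes sd0 :: real and v :: "nat \<Rightarrow> real"
  assumes sd0: "sd0 > 0"
  shows "emeasure (gauss_measure n mu0 sd0)
      {y \<in> space (gauss_measure n mu0 sd0). (\<Sum>i<n. (y i - mu0 i) * v i) > l2norm_sq n v / 2}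
    \<le> ennreal (exp (- (l2norm_sq n v / (8 * sd0\<^sup>2))))"
proof (rule gauss_chernoff[where a = 0 and b = "\<lambda>i. v i / (2 * sd0\<^sup>2)" and c = mu0
      and k = "- (l2norm_sq n v / (4 * sd0\<^sup>2))"])
  have "(\<Sum>i<n. (v i / (2 * sd0\<^sup>2))\<^sup>2 * sd0\<^sup>2 / 2) = l2norm_sq n v / (8 * sd0\<^sup>2)"
    unfolding l2norm_sq_def sum_divide_distrib using sd0
    by (intro sum.cong) (auto simp: field_simps power2_eq_square)
  moreover have "- (l2norm_sq n v / (4 * sd0\<^sup>2)) + l2norm_sq n v / (8 * sd0\<^sup>2) = - (l2norm_sq n v / (8 * sd0\<^sup>2))"
    using sd0 by (simp add: field_simps)
  ultimately show "- (l2norm_sq n v / (4 * sd0\<^sup>2)) - real n / 2 * ln (1 - 2 * 0 * sd0\<^sup>2) +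
      (\<Sum>i<n. 0 * (mu0 i - mu0 i)\<^sup>2 + v i / (2 * sd0\<^sup>2) * (mu0 i - mu0 i) +
        (v i / (2 * sd0\<^sup>2))\<^sup>2 * sd0\<^sup>2 / 2) / (1 - 2 * 0 * sd0\<^sup>2)
      \<le> - (l2norm_sq n v / (8 * sd0\<^sup>2))"
    by simp
next
  fix y assume "y \<in> {y \<in> space (gauss_measure n mu0 sd0). (\<Sum>i<n. (y i - mu0 i) * v i) > l2norm_sq n v / 2}"
  then have "l2norm_sq n v / 2 / (2 * sd0\<^sup>2) \<le> (\<Sum>i<n. (y i - mu0 i) * v i) / (2 * sd0\<^sup>2)"
    by (intro divide_right_mono) auto
  then show "0 \<le> - (l2norm_sq n v / (4 * sd0\<^sup>2)) +
      (\<Sum>i<n. 0 * (y i - mu0 i)\<^sup>2 + v i / (2 * sd0\<^sup>2) * (y i - mu0 i))"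
    by (simp add: sum_divide_distrib mult_ac)
qed (use assms in auto)

text \<open>The mean of the statistic is at least \<open>3 / 4 * l2norm_sq n v\<close>, a quarter
  above the threshold, and its variance is at most \<open>4 * sd0^2 * l2norm_sq n v\<close>. The
  tilt \<open>1 / (16 * sd0^2)\<close> is the quotient of these two numbers.\<close>

lemma gauss_linear_alternative:
  fixes sd sd0 :: real and v :: "nat \<Rightarrow> real"
  assumes sd0: "sd0 > 0" and sd: "0 < sd" "sd \<le> 2 * sd0"
    and mu: "l2norm_sq n (\<lambda>i. mu i - mu0 i - v i) \<le> l2norm_sq n v / 16"
  shows "emeasure (gauss_measure n mu sd)
      {y \<in> space (gauss_measure n mu sd). (\<Sum>i<n. (y i - mu0 i) * v i) \<le> l2norm_sq n v / 2}
    \<le> ennreal (exp (- (l2norm_sq n v / (128 * sd0\<^sup>2))))"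
proof (rule gauss_chernoff[where a = 0 and b = "\<lambda>i. - v i / (16 * sd0\<^sup>2)" and c = mu0
      and k = "l2norm_sq n v / (32 * sd0\<^sup>2)"])
  define V where "V = l2norm_sq n v"
  have V: "V \<ge> 0" by (simp add: V_def l2norm_sq_def sum_nonneg)
  have "(\<Sum>i<n. (- v i / (16 * sd0\<^sup>2))\<^sup>2 * sd\<^sup>2 / 2) = V * (sd / sd0)\<^sup>2 / (512 * sd0\<^sup>2)"
    unfolding V_def l2norm_sq_def sum_divide_distrib sum_distrib_right using sd0
    by (intro sum.cong) (auto simp: field_simps power2_eq_square)
  also have "(sd / sd0)\<^sup>2 \<le> 2\<^sup>2"
    using sd sd0 by (intro power_mono) (auto simp: field_simps)
  then have "V * (sd / sd0)\<^sup>2 / (512 * sd0\<^sup>2) \<le> V * 4 / (512 * sd0\<^sup>2)"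
    using V by (intro divide_right_mono mult_left_mono) auto
  finally have 1: "(\<Sum>i<n. (- v i / (16 * sd0\<^sup>2))\<^sup>2 * sd\<^sup>2 / 2) \<le> V / (128 * sd0\<^sup>2)"
    by simp
  \<comment> \<open>A completed square replaces Cauchy-Schwarz; the weights are such that
    \<open>2 * l2norm_sq n (mu - mu0 - v)\<close> and \<open>V / 8\<close> are both at most
    \<open>V / 8\<close>, so that \<open>V / 4\<close> is lost in all.\<close>
  have "(\<Sum>i<n. 2 * (mu i - mu0 i - v i)\<^sup>2 + (v i)\<^sup>2 / 8 + (mu i - mu0 i - v i) * v i) \<ge> 0"
  proof (rule sum_nonneg)
    fix i
    have "2 * (mu i - mu0 i - v i)\<^sup>2 + (v i)\<^sup>2 / 8 + (mu i - mu0 i - v i) * v i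
      = 2 * (mu i - mu0 i - v i + v i / 4)\<^sup>2"
      by (simp add: power2_eq_square field_simps)
    then show "2 * (mu i - mu0 i - v i)\<^sup>2 + (v i)\<^sup>2 / 8 + (mu i - mu0 i - v i) * v i \<ge> 0" by simp
  qed
  also have "(\<Sum>i<n. 2 * (mu i - mu0 i - v i)\<^sup>2 + (v i)\<^sup>2 / 8 + (mu i - mu0 i - v i) * v i)
     = 2 * l2norm_sq n (\<lambda>i. mu i - mu0 i - v i) + V / 8 + ((\<Sum>i<n. (mu i - mu0 i) * v i) - V)"
    unfolding sum.distrib left_diff_distrib sum_subtractf
    by (simp add: V_def l2norm_sq_def sum_distrib_left sum_divide_distrib power2_eq_square)
  finally have 2: "(\<Sum>i<n. (mu i - mu0 i) * v i) \<ge> 3 / 4 * V"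
    using mu by (simp add: V_def)
  have "(\<Sum>i<n. - v i / (16 * sd0\<^sup>2) * (mu i - mu0 i)) = - ((\<Sum>i<n. (mu i - mu0 i) * v i) / (16 * sd0\<^sup>2))"
    by (simp add: sum_divide_distrib sum_negf mult_ac)
  also have "\<dots> \<le> - (3 / 4 * V / (16 * sd0\<^sup>2))"
    by (intro le_imp_neg_le divide_right_mono 2) simp
  finally have 3: "(\<Sum>i<n. - v i / (16 * sd0\<^sup>2) * (mu i - mu0 i)) \<le> - (3 / 4 * V / (16 * sd0\<^sup>2))" .
  have "V / (32 * sd0\<^sup>2) + (- (3 / 4 * V / (16 * sd0\<^sup>2)) + V / (128 * sd0\<^sup>2)) = - (V / (128 * sd0\<^sup>2))"
    using sd0 by (simp add: field_simps)
  then show "l2norm_sq n v / (32 * sd0\<^sup>2) - real n / 2 * ln (1 - 2 * 0 * sd\<^sup>2) +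
      (\<Sum>i<n. 0 * (mu i - mu0 i)\<^sup>2 + - v i / (16 * sd0\<^sup>2) * (mu i - mu0 i) +
        (- v i / (16 * sd0\<^sup>2))\<^sup>2 * sd\<^sup>2 / 2) / (1 - 2 * 0 * sd\<^sup>2)
      \<le> - (l2norm_sq n v / (128 * sd0\<^sup>2))"
    using 1 3 unfolding V_def[symmetric] sum.distrib by simp
next
  fix y assume "y \<in> {y \<in> space (gauss_measure n mu sd). (\<Sum>i<n. (y i - mu0 i) * v i) \<le> l2norm_sq n v / 2}"
  then have "(\<Sum>i<n. (y i - mu0 i) * v i) / (16 * sd0\<^sup>2) \<le> l2norm_sq n v / 2 / (16 * sd0\<^sup>2)"
    by (intro divide_right_mono) auto
  then show "0 \<le> l2norm_sq n v / (32 * sd0\<^sup>2) +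
      (\<Sum>i<n. 0 * (y i - mu0 i)\<^sup>2 + - v i / (16 * sd0\<^sup>2) * (y i - mu0 i))"
    by (simp add: sum_divide_distrib sum_negf mult_ac)
qed (use assms in auto)

text \<open>Since \<open>sd \<ge> sd0\<close>, the log-ratio has curvature \<open>a \<le> 0\<close>,
  so the integral is finite with weight \<open>w = 2 - 1 / r \<ge> 1\<close>. Half a unit of
  \<open>n * \<delta>^2\<close> in the exponent comes from the variance and one unit from the
  mean.\<close>

lemma gauss_lik_ratio_integral_le:
  fixes sd sd0 \<delta> :: real
  assumes sd0: "sd0 > 0" and sd: "sd > 0" "sd0\<^sup>2 \<le> sd\<^sup>2" "sd\<^sup>2 \<le> sd0\<^sup>2 * (1 + \<delta>)"
    and mu: "l2norm_sq n (\<lambda>i. mu i - mu0 i) \<le> real n * sd0\<^sup>2 * \<delta>\<^sup>2"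
  shows "(\<integral>\<^sup>+y. ennreal (gauss_lik n y mu0 sd0 / gauss_lik n y mu sd) \<partial>gauss_measure n mu0 sd0)
    \<le> ennreal (exp (3 / 2 * (real n * \<delta>\<^sup>2)))"
proof -
  define a where "a = 1 / (2 * sd\<^sup>2) - 1 / (2 * sd0\<^sup>2)"
  define d where "d i = mu0 i - mu i" for i
  define b where "b i = d i / sd\<^sup>2" for i
  define D where "D = l2norm_sq n d"
  define r where "r = sd\<^sup>2 / sd0\<^sup>2"
  define w where "w = 1 - 2 * a * sd0\<^sup>2"
  have r: "1 \<le> r" "r \<le> 1 + \<delta>" using sd sd0 by (auto simp: r_def field_simps)
  have wr: "w = 2 - 1 / r" using sd sd0 by (simp add: w_def a_def r_def field_simps)
  have w1: "w \<ge> 1" using r by (simp add: wr)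
  have D0: "D \<ge> 0" by (simp add: D_def l2norm_sq_def sum_nonneg)
  have "D = l2norm_sq n (\<lambda>i. mu i - mu0 i)"
    by (simp add: D_def l2norm_sq_def d_def power2_commute)
  then have D: "D \<le> real n * sd0\<^sup>2 * \<delta>\<^sup>2" using mu by simp
  have ratio1: "normal_density (mu0 i) sd0 x / normal_density (mu i) sd x
      = sd / sd0 * exp ((d i)\<^sup>2 / (2 * sd\<^sup>2)) * exp (a * (x - mu0 i)\<^sup>2 + b i * (x - mu0 i))" for i x
  proof -
    have e: "- (x - mu0 i)\<^sup>2 / (2 * sd0\<^sup>2) - - (x - mu i)\<^sup>2 / (2 * sd\<^sup>2)
      = (d i)\<^sup>2 / (2 * sd\<^sup>2) + (a * (x - mu0 i)\<^sup>2 + b i * (x - mu0 i))"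
      using sd sd0 by (simp add: a_def b_def d_def field_simps power2_eq_square)
    have "normal_density (mu0 i) sd0 x / normal_density (mu i) sd x
      = (sqrt (2 * pi * sd\<^sup>2) / sqrt (2 * pi * sd0\<^sup>2)) * exp (- (x - mu0 i)\<^sup>2 / (2 * sd0\<^sup>2) - - (x - mu i)\<^sup>2 / (2 * sd\<^sup>2))"
      unfolding normal_density_def exp_diff by simp
    also have "sqrt (2 * pi * sd\<^sup>2) / sqrt (2 * pi * sd0\<^sup>2) = sd / sd0"
      using sd sd0 by (simp add: real_sqrt_mult)
    finally show ?thesis unfolding e by (simp only: exp_add mult.assoc)
  qed
  have ratio: "gauss_lik n y mu0 sd0 / gauss_lik n y mu sd
     = (sd / sd0) ^ n * exp (D / (2 * sd\<^sup>2)) * exp (\<Sum>i<n. a * (y i - mu0 i)\<^sup>2 + b i * (y i - mu0 i))" for y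
    by (simp add: gauss_lik_def prod_dividef[symmetric] ratio1 prod.distrib exp_sum[symmetric]
        D_def l2norm_sq_def sum_divide_distrib del: times_divide_eq_left times_divide_eq_right)
  have sdr: "(sd / sd0) ^ n = exp (real n / 2 * ln r)"
  proof -
    have "sd / sd0 = exp (ln r / 2)"
      using sd sd0 by (simp add: r_def ln_div ln_realpow exp_diff diff_divide_distrib)
    then have "(sd / sd0) ^ n = exp (real n * (ln r / 2))" by (simp only: exp_of_nat_mult)
    then show ?thesis by (simp add: mult.commute)
  qed
  have "(\<integral>\<^sup>+y. ennreal (gauss_lik n y mu0 sd0 / gauss_lik n y mu sd) \<partial>gauss_measure n mu0 sd0)
    = (\<integral>\<^sup>+y. ennreal ((sd / sd0) ^ n * exp (D / (2 * sd\<^sup>2))) *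
        ennreal (exp (\<Sum>i<n. a * (y i - mu0 i)\<^sup>2 + b i * (y i - mu0 i))) \<partial>gauss_measure n mu0 sd0)"
    using sd sd0 by (simp add: ratio ennreal_mult)
  also have "\<dots> = ennreal ((sd / sd0) ^ n * exp (D / (2 * sd\<^sup>2))) *
      (\<integral>\<^sup>+y. ennreal (exp (\<Sum>i<n. a * (y i - mu0 i)\<^sup>2 + b i * (y i - mu0 i))) \<partial>gauss_measure n mu0 sd0)"
    by (rule nn_integral_cmult) measurable
  also have "\<dots> = ennreal ((sd / sd0) ^ n * exp (D / (2 * sd\<^sup>2))) * ennreal ((1 / sqrt w) ^ n *
      exp ((\<Sum>i<n. (b i)\<^sup>2 * sd0\<^sup>2 / 2) / w))"
    using w1 by (subst nn_integral_gauss_measure_exp_quadratic) (auto simp: sd0 w_def)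
  also have "(\<Sum>i<n. (b i)\<^sup>2 * sd0\<^sup>2 / 2) = D / (2 * sd\<^sup>2 * r)"
    unfolding D_def l2norm_sq_def sum_divide_distrib r_def b_def using sd sd0
    by (intro sum.cong) (auto simp: field_simps power2_eq_square)
  also have "(1 / sqrt w) ^ n = exp (- (real n / 2 * ln w))"
  proof -
    have "1 / sqrt w = exp (- (ln w / 2))"
      using w1 by (simp add: exp_minus ln_sqrt[symmetric] inverse_eq_divide)
    then have "(1 / sqrt w) ^ n = exp (real n * - (ln w / 2))"
      by (simp only: exp_of_nat_mult)
    then show ?thesis by (simp add: mult.commute)
  qed
  also have "ennreal ((sd / sd0) ^ n * exp (D / (2 * sd\<^sup>2))) * ennreal (exp (- (real n / 2 * ln w)) *
      exp (D / (2 * sd\<^sup>2 * r) / w))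
     = ennreal (exp (real n / 2 * ln r + D / (2 * sd\<^sup>2) + (- (real n / 2 * ln w) + D / (2 * sd\<^sup>2 * r) / w)))"
    unfolding sdr by (simp only: exp_add) (simp add: ennreal_mult[symmetric])
  also have "\<dots> \<le> ennreal (exp (3 / 2 * (real n * \<delta>\<^sup>2)))"
  proof -
    \<comment> \<open>The first-order terms in \<open>r - 1\<close> cancel, because
      \<open>r / w = r^2 / (2 * r - 1)\<close>. A variance window of relative width
      \<open>\<delta>\<close> thus costs only order \<open>\<delta>^2\<close> per
      coordinate.\<close>
    have "ln r - ln w = ln (r / w)" using r w1 by (simp add: ln_div)
    also have "\<dots> \<le> r / w - 1" using r w1 by (intro ln_le_minus_one) auto
    also have "\<dots> = (r - 1)\<^sup>2 / (2 * r - 1)"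
      using r by (simp add: wr field_simps power2_eq_square)
    also have "\<dots> \<le> (r - 1)\<^sup>2 / 1" using r by (intro divide_left_mono) auto
    also have "\<dots> \<le> \<delta>\<^sup>2" using r by (simp add: power_mono)
    finally have "real n / 2 * (ln r - ln w) \<le> real n / 2 * \<delta>\<^sup>2" by (intro mult_left_mono) auto
    moreover have "D / (2 * sd\<^sup>2) \<le> D / (2 * sd0\<^sup>2)"
      using sd sd0 D0 by (intro divide_left_mono) auto
    moreover have "D / (2 * sd\<^sup>2 * r) / w \<le> D / (2 * sd0\<^sup>2)"
    proof -
      have "sd0\<^sup>2 * (1 * 1) \<le> sd\<^sup>2 * (r * w)"
        using sd r w1 sd0 by (intro mult_mono) auto
      then have "D / (2 * (sd\<^sup>2 * (r * w))) \<le> D / (2 * sd0\<^sup>2)"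
        using sd0 D0 sd r w1 by (intro divide_left_mono) auto
      then show ?thesis by (simp add: mult.assoc)
    qed
    moreover have "D / (2 * sd0\<^sup>2) + D / (2 * sd0\<^sup>2) \<le> real n * \<delta>\<^sup>2"
      using D sd0 by (simp add: field_simps)
    ultimately have "real n / 2 * ln r + D / (2 * sd\<^sup>2) + (- (real n / 2 * ln w) + D / (2 * sd\<^sup>2 * r) / w)
      \<le> 3 / 2 * (real n * \<delta>\<^sup>2)"
      unfolding right_diff_distrib by linarith
    then show ?thesis by (intro ennreal_leI) simp
  qed
  finally show ?thesis .
qed

subsection \<open>Tests for mean and standard deviation\<close>

text \<open>The slack 1 makes the inequality strict, as extracting a member from an infimum
  requires; it is later absorbed into a factor 2.\<close>

lemma covering_number_le_obtain:
  assumes "covering_number \<rho> e A \<le> ennreal x" "0 \<le> x"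
  obtains F where "finite F" "A \<subseteq> (\<Union>c\<in>F. {y. \<rho> c y \<le> e})" "real (card F) \<le> x + 1"
proof -
  have "covering_number \<rho> e A < ennreal (x + 1)"
    using assms by (intro le_less_trans[OF assms(1)]) (simp add: ennreal_less_iff)
  then obtain F where F: "finite F" "A \<subseteq> (\<Union>c\<in>F. {y. \<rho> c y \<le> e})"
      "of_nat (card F) < ennreal (x + 1)"
    unfolding covering_number_def INF_less_iff by auto
  have "ennreal (real (card F)) < ennreal (x + 1)"
    using F(3) by (simp add: ennreal_of_nat_eq_real_of_nat)
  then have "real (card F) < x + 1" by (simp add: ennreal_less_iff)
  then show ?thesis using that F by auto
qed

lemma measurable_l2norm_sq [measurable]:
  "(\<lambda>y. l2norm_sq n (\<lambda>i. y i - c i)) \<in> borel_measurable (gauss_measure n mu sd)"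
  unfolding l2norm_sq_def by measurable

lemma space_gauss_measure: "space (gauss_measure n mu sd) = space (PiM {..<n} (\<lambda>_. lborel))"
  by (rule sets_eq_imp_space_eq) (rule sets_gauss_measure)

text \<open>\<open>V\<close> will hold the shifts \<open>c - mu0\<close> of distant covering
  centres. The last condition says that \<open>y\<close> is closer to \<open>mu0 + v\<close> than to
  \<open>mu0\<close>, which is the likelihood ratio test between two means with a common variance.
  The region lives on the common space of all the laws, since it must not depend on the
  alternative.\<close>

definition gauss_reject ::
  "nat \<Rightarrow> (nat \<Rightarrow> real) \<Rightarrow> real \<Rightarrow> real \<Rightarrow> (nat \<Rightarrow> real) set \<Rightarrow> (nat \<Rightarrow> real) set" where
  "gauss_reject n mu0 sd0 \<kappa> V = {y \<in> space (PiM {..<n} (\<lambda>_. lborel)).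
     l2norm_sq n (\<lambda>i. y i - mu0 i) > real n * sd0\<^sup>2 * (1 + \<kappa>) \<or>
     l2norm_sq n (\<lambda>i. y i - mu0 i) < real n * sd0\<^sup>2 * (1 - \<kappa>) \<or>
     (\<exists>v\<in>V. (\<Sum>i<n. (y i - mu0 i) * v i) > l2norm_sq n v / 2)}"

lemma sets_gauss_reject [measurable]:
  assumes "finite V"
  shows "gauss_reject n mu0 sd0 \<kappa> V \<in> sets (PiM {..<n} (\<lambda>_. lborel))"
  unfolding gauss_reject_def l2norm_sq_def using assms by measurable

text \<open>By the union bound, the cardinality multiplies only the linear term. Entropy thus
  constrains the separation \<open>r\<close> of the centres but not \<open>\<kappa>\<close>.\<close>

lemma gauss_reject_type_I:
  fixes sd0 \<kappa> r :: real
  assumes sd0: "sd0 > 0" and \<kappa>: "0 < \<kappa>" "\<kappa> \<le> 1" and V: "finite V" "\<And>v. v \<in> V \<Longrightarrow> r \<le> l2norm_sq n v"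
  shows "emeasure (gauss_measure n mu0 sd0) (gauss_reject n mu0 sd0 \<kappa> V)
    \<le> ennreal (2 * exp (- (real n * \<kappa>\<^sup>2 / 16)) + real (card V) * exp (- (r / (8 * sd0\<^sup>2))))"
proof -
  let ?G = "gauss_measure n mu0 sd0"
  let ?U = "{y \<in> space ?G. l2norm_sq n (\<lambda>i. y i - mu0 i) > real n * sd0\<^sup>2 * (1 + \<kappa>)}"
  let ?D = "{y \<in> space ?G. l2norm_sq n (\<lambda>i. y i - mu0 i) < real n * sd0\<^sup>2 * (1 - \<kappa>)}"
  let ?T = "\<lambda>v. {y \<in> space ?G. (\<Sum>i<n. (y i - mu0 i) * v i) > l2norm_sq n v / 2}"
  have U: "?U \<in> sets ?G" and D: "?D \<in> sets ?G" and T: "?T v \<in> sets ?G" for v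
    by measurable
  have TV: "(\<Union>v\<in>V. ?T v) \<in> sets ?G" using V T by auto
  have "gauss_reject n mu0 sd0 \<kappa> V = ?U \<union> ?D \<union> (\<Union>v\<in>V. ?T v)"
    unfolding gauss_reject_def space_gauss_measure by auto
  then have "emeasure ?G (gauss_reject n mu0 sd0 \<kappa> V) \<le> emeasure ?G (?U \<union> ?D) + emeasure ?G (\<Union>v\<in>V. ?T v)"
    using emeasure_subadditive[of "?U \<union> ?D" ?G "\<Union>v\<in>V. ?T v"] U D TV by simp
  also have "emeasure ?G (?U \<union> ?D) \<le> emeasure ?G ?U + emeasure ?G ?D"
    by (rule emeasure_subadditive[OF U D])
  also have "emeasure ?G (\<Union>v\<in>V. ?T v) \<le> (\<Sum>v\<in>V. emeasure ?G (?T v))"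
    using V T by (intro emeasure_subadditive_finite) auto
  also have "\<dots> \<le> (\<Sum>v\<in>V. ennreal (exp (- (r / (8 * sd0\<^sup>2)))))"
  proof (rule sum_mono)
    fix v assume "v \<in> V"
    then have "r / (8 * sd0\<^sup>2) \<le> l2norm_sq n v / (8 * sd0\<^sup>2)"
      by (intro divide_right_mono V) auto
    then have "ennreal (exp (- (l2norm_sq n v / (8 * sd0\<^sup>2)))) \<le> ennreal (exp (- (r / (8 * sd0\<^sup>2))))"
      by (intro ennreal_leI) simp
    with gauss_linear_null[OF sd0, of n mu0 v]
    show "emeasure ?G (?T v) \<le> ennreal (exp (- (r / (8 * sd0\<^sup>2))))" by (rule order_trans)
  qed
  also have "\<dots> = ennreal (real (card V) * exp (- (r / (8 * sd0\<^sup>2))))"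
    by (simp add: ennreal_mult ennreal_of_nat_eq_real_of_nat)
  also have "emeasure ?G ?U \<le> ennreal (exp (- (real n * \<kappa>\<^sup>2 / 16)))"
    by (rule gauss_sq_upper[OF sd0 \<kappa>])
  also have "emeasure ?G ?D \<le> ennreal (exp (- (real n * \<kappa>\<^sup>2 / 8)))"
    by (rule gauss_sq_lower[OF sd0 \<kappa>])
  also have "\<dots> \<le> ennreal (exp (- (real n * \<kappa>\<^sup>2 / 16)))"
    by (intro ennreal_leI) simp
  finally show ?thesis
    by (simp add: add_mono ennreal_plus[symmetric] del: ennreal_plus)
qed

lemma l2norm_sq_add_le:
  "l2norm_sq n (\<lambda>i. x i + y i) \<le> 2 * l2norm_sq n x + 2 * l2norm_sq n y"
proof -
  have "(x i + y i)\<^sup>2 \<le> 2 * (x i)\<^sup>2 + 2 * (y i)\<^sup>2" for i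
  proof -
    have "0 \<le> (x i - y i)\<^sup>2" by simp
    then show ?thesis by (simp add: power2_eq_square algebra_simps)
  qed
  then have "(\<Sum>i<n. (x i + y i)\<^sup>2) \<le> (\<Sum>i<n. 2 * (x i)\<^sup>2 + 2 * (y i)\<^sup>2)"
    by (rule sum_mono)
  then show ?thesis by (simp add: l2norm_sq_def sum.distrib sum_distrib_left)
qed

text \<open>Three cases: an inflated \<open>sd\<close> is detected by the squared norm whatever \<open>mu\<close> is; for
  moderate \<open>sd\<close> a distant \<open>mu\<close> is detected by the linear statistic of its covering centre; and
  for \<open>mu\<close> near \<open>mu0\<close> the \<open>dpar\<close>-separation forces \<open>sd\<close> to be too small.\<close>

lemma gauss_reject_type_II:
  fixes sd sd0 \<delta> K M1 M E :: real
  assumes n: "n \<ge> 1" and sd0: "sd0 > 0" and \<delta>: "\<delta> > 0" and sd: "sd > 0"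
    and K: "K > 0" "K * \<delta> \<le> 1 / 2" "128 * E \<le> K\<^sup>2"
    and M1: "M1 \<ge> 4" "128 * E \<le> M1\<^sup>2" "64 * M1\<^sup>2 * \<delta> \<le> K"
    and M: "M \<ge> 0" "M\<^sup>2 = 4 * M1\<^sup>2 + K\<^sup>2"
    and F: "finite F" and c: "c \<in> F" "l2norm_sq n (\<lambda>i. mu i - c i) \<le> real n * sd0\<^sup>2 * \<delta>\<^sup>2"
    and d: "dpar n (mu, sd) (mu0, sd0) \<ge> M * (sd0 * \<delta>)"
    and V: "V = (\<lambda>c i. c i - mu0 i) ` {c \<in> F. l2norm_sq n (\<lambda>i. c i - mu0 i) \<ge> M1\<^sup>2 * (real n * sd0\<^sup>2 * \<delta>\<^sup>2)}"
  shows "emeasure (gauss_measure n mu sd)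
      (space (gauss_measure n mu sd) - gauss_reject n mu0 sd0 (K * \<delta>) V) \<le> ennreal (exp (- (E * (real n * \<delta>\<^sup>2))))"
proof -
  let ?G = "gauss_measure n mu sd"
  let ?R = "space ?G - gauss_reject n mu0 sd0 (K * \<delta>) V"
  define H where "H = real n * \<delta>\<^sup>2"
  have H: "H \<ge> 0" by (simp add: H_def)
  have K\<delta>: "0 < K * \<delta>" using K \<delta> by simp
  have KH: "real n * (K * \<delta>)\<^sup>2 = K\<^sup>2 * H" by (simp add: H_def power_mult_distrib)
  \<comment> \<open>The 128 in the hypotheses on \<open>K\<close> and \<open>M1\<close> is the
    denominator of the weakest type II exponents.\<close>
  have E: "E * H \<le> K\<^sup>2 * H / 128" "E * H \<le> M1\<^sup>2 * H / 128"
    using mult_right_mono[OF K(3) H] mult_right_mono[OF M1(2) H] by simp_all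
  have concl: "emeasure ?G ?R \<le> ennreal (exp (- (E * H)))"
    if "?R \<subseteq> S" "S \<in> sets ?G" "emeasure ?G S \<le> ennreal (exp (- e))" "E * H \<le> e" for S e
  proof -
    have "emeasure ?G ?R \<le> emeasure ?G S" using that by (intro emeasure_mono) auto
    also have "\<dots> \<le> ennreal (exp (- e))" by fact
    also have "\<dots> \<le> ennreal (exp (- (E * H)))" using that by (intro ennreal_leI) simp
    finally show ?thesis .
  qed
  show ?thesis
  proof (cases "sd \<ge> sd0 * (1 + K * \<delta>)")
    case True
    have e: "emeasure ?G {y \<in> space ?G. l2norm_sq n (\<lambda>i. y i - mu0 i) \<le> real n * sd0\<^sup>2 * (1 + K * \<delta>)}
        \<le> ennreal (exp (- (real n * (K * \<delta>)\<^sup>2 / 32)))"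
      by (rule gauss_sq_overdispersed[OF sd0 K\<delta> K(2) True])
    have EH: "E * H \<le> real n * (K * \<delta>)\<^sup>2 / 32"
    proof -
      have "K\<^sup>2 * H / 128 \<le> K\<^sup>2 * H / 32" using H by (intro divide_left_mono) auto
      then show ?thesis using E(1) unfolding KH by linarith
    qed
    show ?thesis unfolding H_def[symmetric]
      by (rule concl[OF _ _ e EH]) (auto simp: gauss_reject_def space_gauss_measure)
  next
    case sd_le: False
    have sd2: "sd \<le> 2 * sd0"
    proof -
      have "sd0 * (1 + K * \<delta>) \<le> sd0 * 2" using sd0 K(2) by (intro mult_left_mono) auto
      then show ?thesis using sd_le by simp
    qed
    define v where "v i = c i - mu0 i" for i
    show ?thesis
    proof (cases "l2norm_sq n v \<ge> M1\<^sup>2 * (real n * sd0\<^sup>2 * \<delta>\<^sup>2)")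
      case True
      have vV: "v \<in> V" using True c(1) unfolding V v_def by auto
      \<comment> \<open>\<open>M1 \<ge> 4\<close> makes the covering radius at most a quarter of the
        length of \<open>v\<close>, as the linear test demands.\<close>
      have "16 * (real n * sd0\<^sup>2 * \<delta>\<^sup>2) \<le> M1\<^sup>2 * (real n * sd0\<^sup>2 * \<delta>\<^sup>2)"
        using power_mono[OF M1(1), of 2] by (intro mult_right_mono) auto
      then have "l2norm_sq n (\<lambda>i. mu i - mu0 i - v i) \<le> l2norm_sq n v / 16"
        using c(2) True by (simp add: v_def)
      from gauss_linear_alternative[OF sd0 sd sd2 this]
      have e: "emeasure ?G {y \<in> space ?G. (\<Sum>i<n. (y i - mu0 i) * v i) \<le> l2norm_sq n v / 2}
          \<le> ennreal (exp (- (l2norm_sq n v / (128 * sd0\<^sup>2))))" .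
      have "M1\<^sup>2 * H / 128 = M1\<^sup>2 * (real n * sd0\<^sup>2 * \<delta>\<^sup>2) / (128 * sd0\<^sup>2)"
        using sd0 by (simp add: H_def)
      also have "\<dots> \<le> l2norm_sq n v / (128 * sd0\<^sup>2)"
        using True by (intro divide_right_mono) auto
      finally have EH: "E * H \<le> l2norm_sq n v / (128 * sd0\<^sup>2)" using E(2) by linarith
      show ?thesis unfolding H_def[symmetric]
        by (rule concl[OF _ _ e EH]) (use vV in \<open>auto simp: gauss_reject_def space_gauss_measure not_less\<close>)
    next
      case False
      have "l2norm_sq n (\<lambda>i. mu i - mu0 i) = l2norm_sq n (\<lambda>i. (mu i - c i) + v i)"
        by (simp add: v_def)
      also have "\<dots> \<le> 2 * l2norm_sq n (\<lambda>i. mu i - c i) + 2 * l2norm_sq n v"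
        by (rule l2norm_sq_add_le)
      also have "\<dots> \<le> 2 * (1 * (real n * sd0\<^sup>2 * \<delta>\<^sup>2)) + 2 * (M1\<^sup>2 * (real n * sd0\<^sup>2 * \<delta>\<^sup>2))"
        using c(2) False by simp
      also have "\<dots> \<le> 2 * (M1\<^sup>2 * (real n * sd0\<^sup>2 * \<delta>\<^sup>2)) + 2 * (M1\<^sup>2 * (real n * sd0\<^sup>2 * \<delta>\<^sup>2))"
        using power_mono[OF M1(1), of 2] by (intro add_right_mono mult_left_mono mult_right_mono) auto
      finally have S: "l2norm_sq n (\<lambda>i. mu i - mu0 i) \<le> real n * (4 * M1\<^sup>2 * (sd0\<^sup>2 * \<delta>\<^sup>2))"
        by (simp add: mult_ac)
      \<comment> \<open>The mean accounts for at most \<open>4 * M1^2\<close> of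
        \<open>M^2 = 4 * M1^2 + K^2\<close>; the remaining \<open>K^2\<close> must come from
        \<open>sd\<close>.\<close>
      have "(M * (sd0 * \<delta>))\<^sup>2 \<le> (dpar n (mu, sd) (mu0, sd0))\<^sup>2"
        using d M(1) sd0 \<delta> by (intro power_mono) auto
      also have "\<dots> = l2norm_sq n (\<lambda>i. mu i - mu0 i) / real n + (sd - sd0)\<^sup>2"
        by (simp add: dpar_def l2norm_sq_def sum_nonneg field_simps)
      also have "l2norm_sq n (\<lambda>i. mu i - mu0 i) / real n \<le> 4 * M1\<^sup>2 * (sd0\<^sup>2 * \<delta>\<^sup>2)"
        using S n by (simp add: field_simps)
      finally have "(K * sd0 * \<delta>)\<^sup>2 \<le> (sd0 - sd)\<^sup>2"
        by (simp add: power_mult_distrib M(2) algebra_simps power2_commute)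
      then have "\<bar>K * sd0 * \<delta>\<bar> \<le> \<bar>sd0 - sd\<bar>" by (simp add: abs_le_square_iff)
      \<comment> \<open>A deviation upwards is excluded by \<open>sd_le\<close>.\<close>
      then have sd': "sd \<le> sd0 * (1 - K * \<delta>)"
        using sd_le sd0 K \<delta> by (auto simp: abs_if algebra_simps split: if_splits)
      \<comment> \<open>The displacement is of order \<open>\<delta>^2\<close>, the allowance of
        order \<open>\<delta>\<close>; smallness of \<open>\<delta>\<close> reconciles them.\<close>
      have "real n * (4 * M1\<^sup>2 * (sd0\<^sup>2 * \<delta>\<^sup>2)) = real n * sd0\<^sup>2 * (\<delta> * (64 * M1\<^sup>2 * \<delta>) / 16)"
        by (simp add: power2_eq_square)
      also have "\<dots> \<le> real n * sd0\<^sup>2 * (\<delta> * K / 16)"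
        using \<delta> M1(3) by (intro mult_left_mono divide_right_mono) auto
      finally have "l2norm_sq n (\<lambda>i. mu i - mu0 i) \<le> real n * sd0\<^sup>2 * (K * \<delta> / 16)"
        using S by (simp add: mult_ac)
      from gauss_sq_underdispersed[OF sd0 K\<delta> K(2) sd sd' this]
      have e: "emeasure ?G {y \<in> space ?G. l2norm_sq n (\<lambda>i. y i - mu0 i) \<ge> real n * sd0\<^sup>2 * (1 - K * \<delta>)}
        \<le> ennreal (exp (- (real n * (K * \<delta>)\<^sup>2 / 128)))" .
      have EH: "E * H \<le> real n * (K * \<delta>)\<^sup>2 / 128" using E(1) unfolding KH .
      show ?thesis unfolding H_def[symmetric]
        by (rule concl[OF _ _ e EH]) (auto simp: gauss_reject_def space_gauss_measure not_less)
    qed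
  qed
qed

subsection \<open>Contraction of the posterior\<close>

lemma emeasure_density_interval_ge:
  fixes g :: "real \<Rightarrow> real"
  assumes gm: "set_borel_measurable lborel {0<..} g" and a: "a > 0" and h: "h \<ge> 0"
    and k: "k \<ge> 0" "\<And>s. a \<le> s \<Longrightarrow> s \<le> a + h \<Longrightarrow> g s \<ge> k"
  shows "ennreal (h * k) \<le> emeasure (density lborel (\<lambda>s. ennreal (indicator {0<..} s * g s))) {a..a+h}"
proof -
  have [measurable]: "(\<lambda>s. indicator {0<..} s * g s) \<in> borel_measurable borel"
    using gm by (simp add: set_borel_measurable_def)
  have "ennreal (h * k) = (\<integral>\<^sup>+s. ennreal k * indicator {a..a+h} s \<partial>lborel)"
    using h k by (simp add: nn_integral_cmult_indicator ennreal_mult mult.commute)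
  also have "\<dots> \<le> (\<integral>\<^sup>+s. ennreal (indicator {0<..} s * g s) * indicator {a..a+h} s \<partial>lborel)"
    using a k by (intro nn_integral_mono) (auto simp: indicator_def intro!: ennreal_leI)
  also have "\<dots> = emeasure (density lborel (\<lambda>s. ennreal (indicator {0<..} s * g s))) {a..a+h}"
    by (subst emeasure_density) auto
  finally show ?thesis .
qed

lemma prob_space_density_set_integrable:
  fixes g :: "real \<Rightarrow> real"
  assumes g0: "\<And>s. s > 0 \<Longrightarrow> g s \<ge> 0" and gi: "set_integrable lborel {0<..} g"
    and g1: "(LBINT s:{0<..}. g s) = 1"
  shows "prob_space (density lborel (\<lambda>s. ennreal (indicator {0<..} s * g s)))"
proof
  have i: "integrable lborel (\<lambda>s. indicator {0<..} s * g s)"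
    using gi by (simp add: set_integrable_def)
  have [measurable]: "(\<lambda>s. indicator {0<..} s * g s) \<in> borel_measurable borel"
    using borel_measurable_integrable[OF i] by simp
  have "(\<integral>\<^sup>+s. ennreal (indicator {0<..} s * g s) \<partial>lborel) = ennreal (\<integral>s. indicator {0<..} s * g s \<partial>lborel)"
    using g0 by (intro nn_integral_eq_integral i AE_I2) (auto simp: indicator_def)
  also have "\<dots> = 1" using g1 by (simp add: set_lebesgue_integral_def)
  finally show "emeasure (density lborel (\<lambda>s. ennreal (indicator {0<..} s * g s)))
      (space (density lborel (\<lambda>s. ennreal (indicator {0<..} s * g s)))) = 1"
    by (simp add: emeasure_density)
qed

text \<open>With \<open>L = 0\<close> the density would be constant on a half-line, hence of mass 0
  or infinite. Positivity matters because the lower bound for the prior mass near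
  \<open>sigma0^2\<close> is proportional to \<open>L\<close>.\<close>

lemma Lipschitz_constant_density_pos:
  fixes g :: "real \<Rightarrow> real"
  assumes g0: "\<And>s. s > 0 \<Longrightarrow> g s \<ge> 0" and gi: "set_integrable lborel {0<..} g"
    and g1: "(LBINT s:{0<..}. g s) = 1" and L0: "L \<ge> 0"
    and L: "\<And>s t. s > 0 \<Longrightarrow> t > 0 \<Longrightarrow> \<bar>g s - g t\<bar> \<le> L * \<bar>s - t\<bar>"
  shows "L > 0"
proof (rule ccontr)
  assume "\<not> L > 0"
  then have "L = 0" using L0 by simp
  then have const: "g s = g 1" if "s > 0" for s using L[of s 1] that by simp
  interpret Q: prob_space "density lborel (\<lambda>s. ennreal (indicator {0<..} s * g s))"
    by (rule prob_space_density_set_integrable[OF g0 gi g1])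
  have gm: "set_borel_measurable lborel {0<..} g"
    using gi unfolding set_integrable_def set_borel_measurable_def by (rule borel_measurable_integrable)
  have "g 1 = 0"
  proof (rule ccontr)
    assume ne: "g 1 \<noteq> 0"
    then have pos: "g 1 > 0" using g0[of 1] by simp
    have ge: "g 1 \<le> g s" if "1 \<le> s" for s using const[of s] that by simp
    \<comment> \<open>The length \<open>2 / g 1\<close> is chosen to give mass 2, more than a
      probability allows.\<close>
    have "ennreal (2 / g 1 * g 1) \<le> emeasure (density lborel (\<lambda>s. ennreal (indicator {0<..} s * g s))) {1..1 + 2 / g 1}"
      by (rule emeasure_density_interval_ge[OF gm]) (use pos ge in auto)
    also have "\<dots> \<le> 1" by (rule Q.measure_le_1)
    finally show False using pos by (simp add: ennreal_le_1)
  qed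
  then have zero: "g s = 0" if "s > 0" for s using const[OF that] by simp
  have "(LBINT s:{0<..}. g s) = (LBINT s::real:{0<..}. 0)"
    unfolding set_lebesgue_integral_def
    by (rule Bochner_Integration.integral_cong) (auto simp: indicator_def zero)
  then show False using g1 by (simp add: set_lebesgue_integral_def)
qed

section \<open>Real-valued posterior against nonnegative integrals\<close>

text \<open>A non-integrable function has Bochner integral 0, so the upper bound survives in that
  case thanks to \<open>b \<ge> 0\<close>.\<close>

lemma integral_le_nn_integral_bound:
  fixes f :: "'a \<Rightarrow> real"
  assumes "\<And>x. 0 \<le> f x" "(\<integral>\<^sup>+x. ennreal (f x) \<partial>M) \<le> ennreal b" "0 \<le> b"
  shows "(\<integral>x. f x \<partial>M) \<le> b"
proof (cases "integrable M f")
  case True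
  then have "ennreal (\<integral>x. f x \<partial>M) \<le> ennreal b"
    using assms by (subst nn_integral_eq_integral[symmetric]) auto
  then show ?thesis using assms by simp
qed (use assms in \<open>simp add: not_integrable_integral_eq\<close>)

lemma gauss_lik_nonneg: "gauss_lik n y mu sd \<ge> 0"
  unfolding gauss_lik_def by (intro prod_nonneg) auto

lemma gauss_lik_pos: "sd > 0 \<Longrightarrow> gauss_lik n y mu sd > 0"
  unfolding gauss_lik_def by (intro prod_pos) (auto intro: normal_density_pos)

text \<open>A non-integrable likelihood gives evidence \<open>0\<close> and hence posterior probability \<open>0\<close>, so the
  bound holds in that case as well.\<close>

lemma posterior_prob_le:
  assumes m: "(\<lambda>\<theta>. gauss_lik n y (fst \<theta>) (sqrt (snd \<theta>))) \<in> borel_measurable P"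
  shows "ennreal (posterior_prob n P Q y)
    \<le> (\<integral>\<^sup>+\<theta>. indicator {\<theta> \<in> space P. Q (fst \<theta>) (sqrt (snd \<theta>))} \<theta> * ennreal (gauss_lik n y (fst \<theta>) (sqrt (snd \<theta>))) \<partial>P)
      / (\<integral>\<^sup>+\<theta>. ennreal (gauss_lik n y (fst \<theta>) (sqrt (snd \<theta>))) \<partial>P)"
proof -
  let ?l = "\<lambda>\<theta>. gauss_lik n y (fst \<theta>) (sqrt (snd \<theta>))"
  let ?q = "\<lambda>\<theta>. (if Q (fst \<theta>) (sqrt (snd \<theta>)) then 1 else 0) * ?l \<theta>"
  define num where "num = (\<integral>\<^sup>+\<theta>. indicator {\<theta> \<in> space P. Q (fst \<theta>) (sqrt (snd \<theta>))} \<theta> * ennreal (?l \<theta>) \<partial>P)"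
  define den where "den = (\<integral>\<^sup>+\<theta>. ennreal (?l \<theta>) \<partial>P)"
  have B: "(\<integral>\<theta>. ?l \<theta> \<partial>P) = enn2real den"
    unfolding den_def using m by (intro integral_eq_nn_integral) (auto simp: gauss_lik_nonneg)
  have nd: "num \<le> den"
    unfolding num_def den_def by (intro nn_integral_mono) (auto simp: indicator_def)
  show ?thesis
  proof (cases "den = 0 \<or> den = \<top>")
    case True
    then have "posterior_prob n P Q y = 0" by (auto simp: posterior_prob_def B)
    then show ?thesis by simp
  next
    case False
    then obtain d where d: "den = ennreal d" "d > 0" by (cases den) (auto simp: less_le)
    obtain m where m: "num = ennreal m" "m \<ge> 0" using nd d by (cases num) (auto simp: top_unique)
    have "(\<integral>\<^sup>+\<theta>. ennreal (?q \<theta>) \<partial>P) = num"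
      unfolding num_def by (intro nn_integral_cong) (auto simp: indicator_def)
    \<comment> \<open>\<open>Q\<close> is arbitrary and the integrand possibly not measurable, so
      only an inequality is available for the numerator.\<close>
    then have "(\<integral>\<theta>. ?q \<theta> \<partial>P) \<le> m"
      using m by (intro integral_le_nn_integral_bound) (auto simp: gauss_lik_nonneg)
    then have "posterior_prob n P Q y \<le> m / d"
      unfolding posterior_prob_def B using d by (simp add: divide_right_mono)
    then have "ennreal (posterior_prob n P Q y) \<le> ennreal (m / d)" by (rule ennreal_leI)
    also have "\<dots> = num / den" using m d by (simp add: divide_ennreal)
    finally show ?thesis by (simp add: num_def den_def)
  qed
qed

lemma posterior_prob_nonneg: "0 \<le> posterior_prob n P Q y"
  unfolding posterior_prob_def
  by (intro divide_nonneg_nonneg integral_nonneg_AE AE_I2) (auto simp: gauss_lik_nonneg)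

lemma sets_joint_prior:
  assumes "sets Pm = sets (PiM {..<n} (\<lambda>_. borel :: real measure))"
  shows "sets (joint_prior Pm g) = sets (PiM {..<n} (\<lambda>_. borel) \<Otimes>\<^sub>M borel)"
  unfolding joint_prior_def using assms by (intro sets_pair_measure_cong) auto

lemma measurable_gauss_lik_pair:
  fixes P :: "((nat \<Rightarrow> real) \<times> real) measure"
  assumes "sets P = sets (PiM {..<n} (\<lambda>_. borel) \<Otimes>\<^sub>M (borel :: real measure))"
  shows "(\<lambda>(\<theta>, y). gauss_lik n y (fst \<theta>) (sqrt (snd \<theta>)))
    \<in> borel_measurable (P \<Otimes>\<^sub>M PiM {..<n} (\<lambda>_. lborel))"
proof -
  have S: "sets (P \<Otimes>\<^sub>M PiM {..<n} (\<lambda>_. lborel)) = sets ((PiM {..<n} (\<lambda>_. borel) \<Otimes>\<^sub>M (borel :: real measure)) \<Otimes>\<^sub>M PiM {..<n} (\<lambda>_. borel :: real measure))"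
    using assms by (intro sets_pair_measure_cong sets_PiM_cong) auto
  show ?thesis unfolding gauss_lik_def normal_density_def case_prod_beta' measurable_cong_sets[OF S refl]
    by measurable
qed

text \<open>The non-asymptotic form for one \<open>n\<close>, with the rate written as
  \<open>sd0 * \<delta>\<close>. The four terms are the null error of the squared distance, that of
  the linear tests, the probability of small evidence, and the prior mass outside \<open>Ms\<close>
  plus the type II error, both divided by the evidence bound.\<close>

lemma posterior_contraction_bound:
  fixes mu0 :: "nat \<Rightarrow> real" and sd0 \<delta> K M1 M E pa pb pc :: real and g :: "real \<Rightarrow> real"
  assumes n: "n \<ge> 1" and sd0: "sd0 > 0" and \<delta>: "\<delta> > 0"
    and Pm: "prob_space Pm" "sets Pm = sets (PiM {..<n} (\<lambda>_. borel :: real measure))"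
    and Q: "prob_space (density lborel (\<lambda>s. ennreal (indicator {0<..} s * g s)))"
    and gm: "set_borel_measurable lborel {0<..} g"
    and K: "K > 0" "K * \<delta> \<le> 1 / 2" "128 * E \<le> K\<^sup>2"
    and M1: "M1 \<ge> 4" "128 * E \<le> M1\<^sup>2" "64 * M1\<^sup>2 * \<delta> \<le> K"
    and M: "M \<ge> 0" "M\<^sup>2 = 4 * M1\<^sup>2 + K\<^sup>2"
    and Ms: "Ms \<in> sets Pm" and F: "finite F"
      "Ms \<subseteq> (\<Union>c\<in>F. {x. l2dist n c x \<le> sqrt (real n) * (sd0 * \<delta>)})"
    and pa: "0 < pa" "pa \<le> measure Pm {mu \<in> space Pm. l2norm_sq n (\<lambda>i. mu i - mu0 i) \<le> real n * (sd0 * \<delta>)\<^sup>2}"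
    and pb: "0 < pb" "ennreal pb \<le> emeasure (density lborel (\<lambda>s. ennreal (indicator {0<..} s * g s)))
        {sd0\<^sup>2 .. sd0\<^sup>2 + sd0\<^sup>2 * \<delta>}"
    and pc: "measure Pm (space Pm - Ms) \<le> pc"
    and H_def: "H = real n * \<delta>\<^sup>2"
  shows "(\<integral>y. posterior_prob n (joint_prior Pm g) (\<lambda>mu sd. dpar n (mu, sd) (mu0, sd0) \<ge> M * (sd0 * \<delta>)) y
      \<partial>gauss_measure n mu0 sd0)
    \<le> 2 * exp (- (K\<^sup>2 * H / 16)) + real (card F) * exp (- (M1\<^sup>2 * H / 8)) + exp (- H)
      + exp (5 / 2 * H) / (pa * pb) * (pc + exp (- (E * H)))"
proof -
  let ?QQ = "density lborel (\<lambda>s. ennreal (indicator {0<..} s * g s))"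
  let ?G = "gauss_measure n mu0 sd0"
  let ?N = "PiM {..<n} (\<lambda>_. lborel :: real measure)"
  define P where "P = joint_prior Pm g"
  define p where "p \<theta> y = gauss_lik n y (fst \<theta>) (sqrt (snd \<theta>))" for \<theta> y
  define p0 where "p0 y = gauss_lik n y mu0 sd0" for y
  interpret Pm: prob_space Pm by fact
  interpret Q: prob_space ?QQ by fact
  interpret PQ: pair_prob_space Pm ?QQ ..
  have P_eq: "P = Pm \<Otimes>\<^sub>M ?QQ" by (simp add: P_def joint_prior_def)
  have P_prob: "prob_space P" unfolding P_eq by (rule PQ.prob_space_axioms)
  have P_sf: "sigma_finite_measure P" by (rule prob_space_imp_sigma_finite[OF P_prob])
  interpret L: product_sigma_finite "\<lambda>_::nat. lborel :: real measure" by standard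
  have N_sf: "sigma_finite_measure ?N" by (rule L.sigma_finite) simp
  have P_sets: "sets P = sets (PiM {..<n} (\<lambda>_. borel) \<Otimes>\<^sub>M borel)"
    unfolding P_def by (rule sets_joint_prior[OF Pm(2)])
  have pm: "(\<lambda>(\<theta>, y). p \<theta> y) \<in> borel_measurable (P \<Otimes>\<^sub>M ?N)"
    unfolding p_def by (rule measurable_gauss_lik_pair[OF P_sets])
  have pm': "(\<lambda>(\<theta>, y). ennreal (p \<theta> y)) \<in> borel_measurable (P \<Otimes>\<^sub>M ?N)"
    using pm by (auto simp: case_prod_beta')
  have p0m: "p0 \<in> borel_measurable ?N"
    unfolding p0_def gauss_lik_def by measurable
  have G_eq: "?G = density ?N (\<lambda>y. ennreal (p0 y))"
    unfolding p0_def by (rule gauss_measure_density[OF sd0])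

  define A where "A = {mu \<in> space Pm. l2norm_sq n (\<lambda>i. mu i - mu0 i) \<le> real n * (sd0 * \<delta>)\<^sup>2}
      \<times> {sd0\<^sup>2 .. sd0\<^sup>2 + sd0\<^sup>2 * \<delta>}"
  have A1: "{mu \<in> space Pm. l2norm_sq n (\<lambda>i. mu i - mu0 i) \<le> real n * (sd0 * \<delta>)\<^sup>2} \<in> sets Pm"
  proof -
    have "(\<lambda>mu. l2norm_sq n (\<lambda>i. mu i - mu0 i)) \<in> borel_measurable Pm"
      unfolding l2norm_sq_def measurable_cong_sets[OF Pm(2) refl] by measurable
    then show ?thesis by measurable
  qed
  have A: "A \<in> sets P" unfolding A_def P_eq using A1 by (intro pair_measureI) auto
  define m where "m = measure P A"
  have mA: "emeasure P A = ennreal m"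
    unfolding m_def using P_prob by (intro finite_measure.emeasure_eq_measure) (simp add: prob_space_def)
  have "ennreal (pa * pb) = ennreal pa * ennreal pb" using pa pb by (simp add: ennreal_mult)
  also have "\<dots> \<le> emeasure P A"
    unfolding A_def P_eq using pa pb A1
    by (subst Q.emeasure_pair_measure_Times) (auto intro!: mult_mono simp: Pm.emeasure_eq_measure intro: ennreal_leI)
  finally have m: "pa * pb \<le> m"
    unfolding mA by (subst (asm) ennreal_le_iff) (auto simp: m_def)
  have pab: "pa * pb > 0" using pa pb by simp
  have m0: "m > 0" using m pab by linarith
  \<comment> \<open>Chosen so that \<open>t\<close> times the bound \<open>exp (3 / 2 * H)\<close>
    on the chi-square type integral is \<open>exp (- H)\<close>.\<close>
  define t where "t = exp (- (5 / 2 * H))"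
  have t: "t > 0" by (simp add: t_def)
  have bad: "emeasure ?G {y \<in> space ?N. (\<integral>\<^sup>+\<theta>. ennreal (p \<theta> y) \<partial>P) < ennreal (t * m) * ennreal (p0 y)}
      \<le> ennreal (exp (- H))"
  proof -
    have "emeasure ?G {y \<in> space ?N. (\<integral>\<^sup>+\<theta>. ennreal (p \<theta> y) \<partial>P) < ennreal (t * m) * ennreal (p0 y)}
      \<le> ennreal (t * exp (3 / 2 * H))"
      unfolding G_eq
    proof (rule emeasure_evidence_less[OF P_sf N_sf pm p0m _ A mA m0])
      fix \<theta> y assume "\<theta> \<in> A"
      then have "sd0\<^sup>2 \<le> snd \<theta>" by (auto simp: A_def)
      moreover have "sd0\<^sup>2 > 0" using sd0 by simp
      ultimately have "snd \<theta> > 0" by linarith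
      then show "p \<theta> y > 0" by (simp add: p_def gauss_lik_pos)
    next
      fix \<theta> assume \<theta>: "\<theta> \<in> A"
      then have s: "sd0\<^sup>2 \<le> snd \<theta>" "snd \<theta> \<le> sd0\<^sup>2 * (1 + \<delta>)"
          "l2norm_sq n (\<lambda>i. fst \<theta> i - mu0 i) \<le> real n * sd0\<^sup>2 * \<delta>\<^sup>2"
        by (auto simp: A_def algebra_simps power_mult_distrib)
      have s0: "snd \<theta> > 0" using less_le_trans[OF _ s(1), of 0] sd0 by simp
      show "(\<integral>\<^sup>+y. ennreal (p0 y / p \<theta> y) \<partial>density ?N (\<lambda>y. ennreal (p0 y))) \<le> ennreal (exp (3 / 2 * H))"
        unfolding G_eq[symmetric] unfolding p0_def p_def H_def
        by (rule gauss_lik_ratio_integral_le) (use s s0 sd0 in auto)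
    qed (auto simp: p0_def gauss_lik_pos sd0 t)
    also have "t * exp (3 / 2 * H) = exp (- H)"
      by (simp add: t_def exp_add[symmetric])
    finally show ?thesis .
  qed

  \<comment> \<open>Only centres at distance at least \<open>M1 * sqrt n * eps\<close> from
    \<open>mu0\<close> get a linear test; nearer ones could not be separated with the required
    error.\<close>
  define V where "V = (\<lambda>c i. c i - mu0 i) ` {c \<in> F. l2norm_sq n (\<lambda>i. c i - mu0 i) \<ge> M1\<^sup>2 * (real n * sd0\<^sup>2 * \<delta>\<^sup>2)}"
  have V: "finite V" using F by (simp add: V_def)
  have cardV: "card V \<le> card F"
    unfolding V_def by (rule order_trans[OF card_image_le card_mono]) (use F in auto)
  define R where "R = gauss_reject n mu0 sd0 (K * \<delta>) V"
  have R: "R \<in> sets ?N" unfolding R_def by (rule sets_gauss_reject[OF V])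
  have typeI: "emeasure ?G R \<le> ennreal (2 * exp (- (K\<^sup>2 * H / 16)) + real (card F) * exp (- (M1\<^sup>2 * H / 8)))"
  proof -
    have "emeasure ?G R \<le> ennreal (2 * exp (- (real n * (K * \<delta>)\<^sup>2 / 16))
        + real (card V) * exp (- (M1\<^sup>2 * (real n * sd0\<^sup>2 * \<delta>\<^sup>2) / (8 * sd0\<^sup>2))))"
      unfolding R_def by (rule gauss_reject_type_I[OF sd0]) (use K \<delta> V in \<open>auto simp: V_def\<close>)
    also have "real n * (K * \<delta>)\<^sup>2 = K\<^sup>2 * H" by (simp add: H_def power_mult_distrib)
    also have "M1\<^sup>2 * (real n * sd0\<^sup>2 * \<delta>\<^sup>2) / (8 * sd0\<^sup>2) = M1\<^sup>2 * H / 8"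
      using sd0 by (simp add: H_def)
    also have "ennreal (2 * exp (- (K\<^sup>2 * H / 16)) + real (card V) * exp (- (M1\<^sup>2 * H / 8)))
      \<le> ennreal (2 * exp (- (K\<^sup>2 * H / 16)) + real (card F) * exp (- (M1\<^sup>2 * H / 8)))"
      using cardV by (intro ennreal_leI add_left_mono mult_right_mono) auto
    finally show ?thesis .
  qed

  define U where "U = {\<theta> \<in> space P. dpar n (fst \<theta>, sqrt (snd \<theta>)) (mu0, sd0) \<ge> M * (sd0 * \<delta>)}"
  have U: "U \<in> sets P"
  proof -
    have "(\<lambda>\<theta>. dpar n (fst \<theta>, sqrt (snd \<theta>)) (mu0, sd0)) \<in> borel_measurable P"
      unfolding dpar_def measurable_cong_sets[OF P_sets refl] fst_conv snd_conv by measurable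
    then show ?thesis unfolding U_def by measurable
  qed
  have typeII: "(\<integral>\<^sup>+\<theta>. indicator U \<theta> * emeasure (density ?N (\<lambda>y. ennreal (p \<theta> y))) (space ?N - R) \<partial>P)
      \<le> ennreal (pc + exp (- (E * H)))"
  proof -
    have sm: "(space Pm - Ms) \<times> space ?QQ \<in> sets P"
      unfolding P_eq using Ms by (intro pair_measureI) auto
    \<comment> \<open>The Gaussian identities are stated for a positive standard deviation, so the
      null set where \<open>snd \<theta> \<le> 0\<close> is split off.\<close>
    have "AE s in ?QQ. s > 0"
      using gm by (subst AE_density) (auto simp: set_borel_measurable_def indicator_def)
    moreover have "{\<theta> \<in> space P. snd \<theta> > 0} \<in> sets P"
    proof -
      have "snd \<in> borel_measurable P"
        unfolding measurable_cong_sets[OF P_sets refl] by measurable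
      then show ?thesis by measurable
    qed
    ultimately have AE_pos: "AE \<theta> in P. snd \<theta> > 0"
      unfolding P_eq by (intro PQ.AE_pair_measure) auto
    have "(\<integral>\<^sup>+\<theta>. indicator U \<theta> * emeasure (density ?N (\<lambda>y. ennreal (p \<theta> y))) (space ?N - R) \<partial>P)
      \<le> (\<integral>\<^sup>+\<theta>. indicator ((space Pm - Ms) \<times> space ?QQ) \<theta> + ennreal (exp (- (E * H))) \<partial>P)"
    proof (rule nn_integral_mono_AE)
      show "AE \<theta> in P. indicator U \<theta> * emeasure (density ?N (\<lambda>y. ennreal (p \<theta> y))) (space ?N - R)
        \<le> indicator ((space Pm - Ms) \<times> space ?QQ) \<theta> + ennreal (exp (- (E * H)))"
        using AE_pos AE_space
      proof eventually_elim
        case (elim \<theta>)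
        define sd where "sd = sqrt (snd \<theta>)"
        have sd: "sd > 0" using elim by (simp add: sd_def)
        have eq: "density ?N (\<lambda>y. ennreal (p \<theta> y)) = gauss_measure n (fst \<theta>) sd"
          unfolding p_def sd_def[symmetric] by (rule gauss_measure_density[OF sd, symmetric])
        have fs: "fst \<theta> \<in> space Pm" using elim by (auto simp: P_eq space_pair_measure)
        \<comment> \<open>Outside \<open>U\<close> the left side is 0. Outside \<open>Ms\<close> the
          type II error is bounded by 1 and charged to the prior mass of the complement.\<close>
        show ?case
        proof (cases "\<theta> \<in> U \<and> fst \<theta> \<in> Ms")
          case False
          have "indicator U \<theta> * emeasure (gauss_measure n (fst \<theta>) sd) (space ?N - R) \<le> 1 * 1"
            by (intro mult_mono prob_space.measure_le_1[OF prob_space_gauss_measure[OF sd]])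
               (auto simp: indicator_def)
          then show ?thesis using False fs elim unfolding eq
            by (cases "\<theta> \<in> U") (auto simp: indicator_def mem_Times_iff add_increasing2)
        next
          case True
          then obtain c where c: "c \<in> F" "l2dist n c (fst \<theta>) \<le> sqrt (real n) * (sd0 * \<delta>)"
            using F by auto
          have "(l2dist n c (fst \<theta>))\<^sup>2 \<le> (sqrt (real n) * (sd0 * \<delta>))\<^sup>2"
            using c(2) by (intro power_mono) (auto simp: l2dist_def sum_nonneg)
          then have c2: "l2norm_sq n (\<lambda>i. fst \<theta> i - c i) \<le> real n * sd0\<^sup>2 * \<delta>\<^sup>2"
            by (simp add: l2dist_def l2norm_sq_def sum_nonneg power_mult_distrib power2_commute mult.assoc)
          have dU: "dpar n (fst \<theta>, sd) (mu0, sd0) \<ge> M * (sd0 * \<delta>)"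
            using True by (simp add: U_def sd_def)
          have "emeasure (gauss_measure n (fst \<theta>) sd) (space (gauss_measure n (fst \<theta>) sd) - R)
            \<le> ennreal (exp (- (E * H)))"
            unfolding R_def H_def
            by (rule gauss_reject_type_II[OF n sd0 \<delta> sd K M1 M F(1) c(1) c2 dU V_def])
          then show ?thesis using True unfolding eq space_gauss_measure by (simp add: add_increasing)
        qed
      qed
    qed
    also have "\<dots> = emeasure P ((space Pm - Ms) \<times> space ?QQ) + ennreal (exp (- (E * H)))"
      using sm prob_space.emeasure_space_1[OF P_prob] by (simp add: nn_integral_add)
    also have "emeasure P ((space Pm - Ms) \<times> space ?QQ) = emeasure Pm (space Pm - Ms) * emeasure ?QQ (space ?QQ)"
      unfolding P_eq using Ms by (intro Q.emeasure_pair_measure_Times) auto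
    also have "\<dots> \<le> ennreal pc"
      unfolding Q.emeasure_space_1 using pc by (simp add: Pm.emeasure_eq_measure ennreal_leI)
    finally show ?thesis
      using order_trans[OF measure_nonneg pc] by (simp add: ennreal_plus)
  qed

  have pc0: "pc \<ge> 0" using order_trans[OF measure_nonneg pc] .
  have tm: "0 < t * m" using t m0 by simp
  have "(\<integral>\<^sup>+y. ennreal (posterior_prob n P (\<lambda>mu sd. dpar n (mu, sd) (mu0, sd0) \<ge> M * (sd0 * \<delta>)) y) \<partial>?G)
    \<le> (\<integral>\<^sup>+y. (\<integral>\<^sup>+\<theta>. indicator U \<theta> * ennreal (p \<theta> y) \<partial>P) / (\<integral>\<^sup>+\<theta>. ennreal (p \<theta> y) \<partial>P) \<partial>?G)"
  proof (rule nn_integral_mono)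
    fix y assume "y \<in> space ?G"
    then have "y \<in> space ?N" by (simp add: space_gauss_measure)
    then have "(\<lambda>\<theta>. p \<theta> y) \<in> borel_measurable P"
      using measurable_Pair1[OF pm] by simp
    then show "ennreal (posterior_prob n P (\<lambda>mu sd. dpar n (mu, sd) (mu0, sd0) \<ge> M * (sd0 * \<delta>)) y)
      \<le> (\<integral>\<^sup>+\<theta>. indicator U \<theta> * ennreal (p \<theta> y) \<partial>P) / (\<integral>\<^sup>+\<theta>. ennreal (p \<theta> y) \<partial>P)"
      unfolding U_def p_def by (rule posterior_prob_le)
  qed
  also have "\<dots> \<le> emeasure ?G R
      + emeasure ?G {y \<in> space ?N. (\<integral>\<^sup>+\<theta>. ennreal (p \<theta> y) \<partial>P) < ennreal (t * m) * ennreal (p0 y)}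
      + (\<integral>\<^sup>+\<theta>. indicator U \<theta> * emeasure (density ?N (\<lambda>y. ennreal (p \<theta> y))) (space ?N - R) \<partial>P) / ennreal (t * m)"
    unfolding G_eq using p0m tm
    by (intro nn_integral_posterior_le[OF P_sf N_sf pm']) (auto simp: U R)
  also have "\<dots> \<le> ennreal (2 * exp (- (K\<^sup>2 * H / 16)) + real (card F) * exp (- (M1\<^sup>2 * H / 8)))
      + ennreal (exp (- H)) + ennreal (pc + exp (- (E * H))) / ennreal (t * m)"
    by (intro add_mono typeI bad divide_right_mono_ennreal typeII)
  also have "\<dots> = ennreal (2 * exp (- (K\<^sup>2 * H / 16)) + real (card F) * exp (- (M1\<^sup>2 * H / 8)) + exp (- H)
      + (pc + exp (- (E * H))) / (t * m))"
    using pc0 tm by (simp add: divide_ennreal ennreal_plus[symmetric] add_nonneg_nonneg del: ennreal_plus)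
  also have "\<dots> \<le> ennreal (2 * exp (- (K\<^sup>2 * H / 16)) + real (card F) * exp (- (M1\<^sup>2 * H / 8)) + exp (- H)
      + exp (5 / 2 * H) / (pa * pb) * (pc + exp (- (E * H))))"
  proof (intro ennreal_leI add_left_mono)
    have "(pc + exp (- (E * H))) / (t * m) \<le> (pc + exp (- (E * H))) / (t * (pa * pb))"
      using pc0 t m m0 pab by (intro divide_left_mono mult_left_mono) auto
    also have "\<dots> = exp (5 / 2 * H) / (pa * pb) * (pc + exp (- (E * H)))"
      by (simp add: t_def exp_minus divide_simps)
    finally show "(pc + exp (- (E * H))) / (t * m) \<le> exp (5 / 2 * H) / (pa * pb) * (pc + exp (- (E * H)))" .
  qed
  finally show ?thesis
    unfolding P_def[symmetric] using pc0 pab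
    by (intro integral_le_nn_integral_bound posterior_prob_nonneg) (auto intro!: add_nonneg_nonneg)
qed

text \<open>Quantifying \<open>E0\<close> before all other data expresses that "sufficiently large"
  depends on \<open>Cbar\<close> and \<open>B\<close> alone.\<close>

theorem theorem4:
  fixes B Cbar :: real
  assumes "B > 0" and "Cbar > 0"
  shows "\<exists>E0. \<forall>(mu0 :: nat \<Rightarrow> nat \<Rightarrow> real) (sigma0 :: nat \<Rightarrow> real) (g :: real \<Rightarrow> real) (L :: real)
           (eps :: nat \<Rightarrow> real) (Pmu :: nat \<Rightarrow> (nat \<Rightarrow> real) measure)
           (Mset :: nat \<Rightarrow> (nat \<Rightarrow> real) set) (Dbar :: real) (Ebar :: real).
    ( Ebar \<ge> E0 \<and> Dbar > 0 \<and> Ebar > 0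
    \<and> (\<forall>n\<ge>1. sigma0 n > 0 \<and> (sigma0 n)\<^sup>2 > real n powr (- B))
    \<comment> \<open>prior of sigma^2: density g on (0,inf), L-Lipschitz there, with O(1/t) tails\<close>
    \<and> (\<forall>s>0. g s \<ge> 0)
    \<and> set_integrable lborel {0<..} g \<and> (LBINT s:{0<..}. g s) = 1
    \<and> L \<ge> 0 \<and> (\<forall>s>0. \<forall>t>0. \<bar>g s - g t\<bar> \<le> L * \<bar>s - t\<bar>)
    \<and> (\<lambda>t. LBINT s:{t<..}. g s) \<in> O[at_top](\<lambda>t. 1 / t)
    \<comment> \<open>prior of mu (for each n), a probability measure on R^n\<close>
    \<and> (\<forall>n. prob_space (Pmu n) \<and> sets (Pmu n) = sets (PiM {..<n} (\<lambda>_. borel)))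
    \<comment> \<open>rate eps_n\<close>
    \<and> (\<forall>n\<ge>1. eps n > 0)
    \<and> (\<lambda>n. eps n / sigma0 n) \<longlonglongrightarrow> 0
    \<and> (\<forall>n\<ge>1. real n * (eps n)\<^sup>2 / (sigma0 n)\<^sup>2 \<ge> ln (real n))
    \<and> (\<forall>n\<ge>1. g ((sigma0 n)\<^sup>2) \<ge> 2 * L * sigma0 n * eps n)
    \<comment> \<open>prior mass, entropy and remaining-mass conditions\<close>
    \<and> (\<forall>n\<ge>1. measure (Pmu n) {mu \<in> space (Pmu n). l2norm_sq n (\<lambda>i. mu i - mu0 n i) \<le> real n * (eps n)\<^sup>2}
               \<ge> exp (- Cbar * real n * (eps n)\<^sup>2 / (sigma0 n)\<^sup>2))
    \<and> (\<forall>n\<ge>1. Mset n \<in> sets (Pmu n)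
          \<and> covering_number (l2dist n) (sqrt (real n) * eps n) (Mset n)
               \<le> ennreal (exp (Dbar * real n * (eps n)\<^sup>2 / (sigma0 n)\<^sup>2))
          \<and> measure (Pmu n) (space (Pmu n) - Mset n)
               \<le> exp (- Ebar * real n * (eps n)\<^sup>2 / (sigma0 n)\<^sup>2)) )
    \<longrightarrow> (\<exists>M>0. (\<lambda>n. \<integral>y. posterior_prob n (joint_prior (Pmu n) g)
                    (\<lambda>mu sd. dpar n (mu, sd) (mu0 n, sigma0 n) \<ge> M * eps n) y
                  \<partial>(gauss_measure n (mu0 n) (sigma0 n))) \<longlonglongrightarrow> 0)"
proof -
  \<comment> \<open>The evidence bound costs \<open>Cbar + (2 * B + 1) + 5 / 2\<close> in the
    exponent; \<open>E\<close> exceeds this by \<open>3 / 2\<close>, which leaves a decaying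
    factor.\<close>
  define E where "E = Cbar + 2 * B + 5"
  have E5: "E \<ge> 5" using assms by (simp add: E_def)
  show ?thesis
  proof (rule exI[of _ E], intro allI impI, elim conjE)
    fix mu0 :: "nat \<Rightarrow> nat \<Rightarrow> real" and sigma0 :: "nat \<Rightarrow> real" and g :: "real \<Rightarrow> real" and L :: real
      and eps :: "nat \<Rightarrow> real" and Pmu :: "nat \<Rightarrow> (nat \<Rightarrow> real) measure"
      and Mset :: "nat \<Rightarrow> (nat \<Rightarrow> real) set" and Dbar Ebar :: real
    assume Ebar: "E \<le> Ebar" and Dbar: "0 < Dbar"
      and sigma0: "\<forall>n\<ge>1. sigma0 n > 0 \<and> (sigma0 n)\<^sup>2 > real n powr (- B)"
      and g0: "\<forall>s>0. g s \<ge> 0" and gi: "set_integrable lborel {0<..} g" and g1: "(LBINT s:{0<..}. g s) = 1"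
      and L0: "L \<ge> 0" and Lip: "\<forall>s>0. \<forall>t>0. \<bar>g s - g t\<bar> \<le> L * \<bar>s - t\<bar>"
      and Pmu: "\<forall>n. prob_space (Pmu n) \<and> sets (Pmu n) = sets (PiM {..<n} (\<lambda>_. borel))"
      and eps: "\<forall>n\<ge>1. eps n > 0" and lim: "(\<lambda>n. eps n / sigma0 n) \<longlonglongrightarrow> 0"
      and rate: "\<forall>n\<ge>1. real n * (eps n)\<^sup>2 / (sigma0 n)\<^sup>2 \<ge> ln (real n)"
      and gs: "\<forall>n\<ge>1. g ((sigma0 n)\<^sup>2) \<ge> 2 * L * sigma0 n * eps n"
      and mass: "\<forall>n\<ge>1. measure (Pmu n) {mu \<in> space (Pmu n). l2norm_sq n (\<lambda>i. mu i - mu0 n i) \<le> real n * (eps n)\<^sup>2}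
               \<ge> exp (- Cbar * real n * (eps n)\<^sup>2 / (sigma0 n)\<^sup>2)"
      and sieve: "\<forall>n\<ge>1. Mset n \<in> sets (Pmu n)
          \<and> covering_number (l2dist n) (sqrt (real n) * eps n) (Mset n)
               \<le> ennreal (exp (Dbar * real n * (eps n)\<^sup>2 / (sigma0 n)\<^sup>2))
          \<and> measure (Pmu n) (space (Pmu n) - Mset n)
               \<le> exp (- Ebar * real n * (eps n)\<^sup>2 / (sigma0 n)\<^sup>2)"
    define K where "K = sqrt (128 * E)"
    \<comment> \<open>The summand 4 is for the covering radius, \<open>128 * E\<close> for the type
      II error, and \<open>8 * (Dbar + 1)\<close> makes \<open>exp (- (M1^2 * H / 8))\<close> beat
      the entropy with \<open>exp (- H)\<close> to spare.\<close>
    define M1 where "M1 = 4 + sqrt (128 * E + 8 * (Dbar + 1))"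
    define M where "M = sqrt (4 * M1\<^sup>2 + K\<^sup>2)"
    have K: "K > 0" "K\<^sup>2 = 128 * E" using E5 by (auto simp: K_def)
    have M1: "M1 \<ge> 4" "128 * E + 8 * (Dbar + 1) \<le> M1\<^sup>2"
    proof -
      have "sqrt (128 * E + 8 * (Dbar + 1)) \<ge> 0" using E5 Dbar by simp
      then show "M1 \<ge> 4" by (simp add: M1_def)
      have "(sqrt (128 * E + 8 * (Dbar + 1)))\<^sup>2 \<le> M1\<^sup>2"
        unfolding M1_def using E5 Dbar by (intro power_mono) auto
      then show "128 * E + 8 * (Dbar + 1) \<le> M1\<^sup>2" using E5 Dbar by simp
    qed
    have M: "M \<ge> 0" "M\<^sup>2 = 4 * M1\<^sup>2 + K\<^sup>2" by (auto simp: M_def)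
    have M0: "M > 0"
    proof -
      have "4 * M1\<^sup>2 + K\<^sup>2 > 0" using K(2) E5 by (intro add_nonneg_pos) auto
      then show ?thesis unfolding M_def by simp
    qed
    have L: "L > 0"
      by (rule Lipschitz_constant_density_pos[OF _ gi g1 L0]) (use g0 Lip in auto)
    let ?Q = "density lborel (\<lambda>s. ennreal (indicator {0<..} s * g s))"
    have Q: "prob_space ?Q"
      by (rule prob_space_density_set_integrable[OF _ gi g1]) (use g0 in auto)
    have gm: "set_borel_measurable lborel {0<..} g"
      using gi unfolding set_integrable_def set_borel_measurable_def by (rule borel_measurable_integrable)
    define post where "post n = (\<integral>y. posterior_prob n (joint_prior (Pmu n) g)
        (\<lambda>mu sd. dpar n (mu, sd) (mu0 n, sigma0 n) \<ge> M * eps n) y \<partial>gauss_measure n (mu0 n) (sigma0 n))" for n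
    have bound: "post n \<le> (5 + 2 / L) * inverse (real n)"
      if n3: "n \<ge> 3" and small1: "eps n / sigma0 n < 1 / (2 * K)" and small2: "eps n / sigma0 n < K / (64 * M1\<^sup>2)" for n
    proof -
      have n: "n \<ge> 1" using n3 by simp
      define \<delta> where "\<delta> = eps n / sigma0 n"
      define H where "H = real n * \<delta>\<^sup>2"
      have s0: "sigma0 n > 0" and s0B: "(sigma0 n)\<^sup>2 > real n powr (- B)" using sigma0 n by auto
      have \<delta>: "\<delta> > 0" using eps s0 n by (simp add: \<delta>_def)
      have e: "eps n = sigma0 n * \<delta>" using s0 by (simp add: \<delta>_def)
      have Hx: "x * real n * (eps n)\<^sup>2 / (sigma0 n)\<^sup>2 = x * H" for x
        using s0 by (simp add: e H_def power_mult_distrib)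
      have Hln: "ln (real n) \<le> H" using rate[rule_format, OF n] Hx[of 1] by simp
      have ln1: "1 \<le> ln (real n)"
      proof -
        \<comment> \<open>This is the reason for \<open>n \<ge> 3\<close>:
          \<open>ln n \<ge> 1\<close> yields \<open>H \<ge> 1\<close>.\<close>
        have "exp 1 \<le> real n" using exp_le n3 by linarith
        then show ?thesis using n3 by (subst ln_ge_iff) auto
      qed
      have H1: "H \<ge> 1" using Hln ln1 by simp
      have "covering_number (l2dist n) (sqrt (real n) * eps n) (Mset n) \<le> ennreal (exp (Dbar * H))"
        using sieve[rule_format, OF n, unfolded Hx] by simp
      then obtain F where F: "finite F" "Mset n \<subseteq> (\<Union>c\<in>F. {y. l2dist n c y \<le> sqrt (real n) * eps n})"
          "real (card F) \<le> exp (Dbar * H) + 1"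
        by (rule covering_number_le_obtain) auto
      \<comment> \<open>Interval length times a lower bound for \<open>g\<close>: the length is
        \<open>sigma0 * eps\<close>, over which \<open>g\<close> falls by at most
        \<open>L * sigma0 * eps\<close> from a value of at least twice that.\<close>
      define pb where "pb = (sigma0 n)\<^sup>2 * \<delta> * (L * ((sigma0 n)\<^sup>2 * \<delta>))"
      have h: "(sigma0 n)\<^sup>2 * \<delta> > 0" using s0 \<delta> by simp
      have pb0: "pb > 0" using h L by (simp add: pb_def)
      have pbQ: "ennreal pb \<le> emeasure ?Q {(sigma0 n)\<^sup>2..(sigma0 n)\<^sup>2 + (sigma0 n)\<^sup>2 * \<delta>}"
        unfolding pb_def
      proof (rule emeasure_density_interval_ge[OF gm])
        fix s assume s: "(sigma0 n)\<^sup>2 \<le> s" "s \<le> (sigma0 n)\<^sup>2 + (sigma0 n)\<^sup>2 * \<delta>"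
        have "(sigma0 n)\<^sup>2 > 0" using s0 by simp
        moreover from this have "s > 0" using s(1) by linarith
        ultimately have "\<bar>g s - g ((sigma0 n)\<^sup>2)\<bar> \<le> L * \<bar>s - (sigma0 n)\<^sup>2\<bar>"
          using Lip by blast
        also have "\<dots> \<le> L * ((sigma0 n)\<^sup>2 * \<delta>)" using L s by (intro mult_left_mono) auto
        finally have "g s \<ge> g ((sigma0 n)\<^sup>2) - L * ((sigma0 n)\<^sup>2 * \<delta>)" by linarith
        moreover have "g ((sigma0 n)\<^sup>2) \<ge> 2 * (L * ((sigma0 n)\<^sup>2 * \<delta>))"
          using gs[rule_format, OF n] by (simp add: e power2_eq_square mult_ac)
        ultimately show "L * ((sigma0 n)\<^sup>2 * \<delta>) \<le> g s" by linarith
      qed (use s0 h L in auto)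
      \<comment> \<open>\<open>sigma0^2 > n powr (- B) \<ge> exp (- (B * H))\<close> and
        \<open>\<delta>^2 = H / n \<ge> 1 / n \<ge> exp (- H)\<close>; \<open>pb\<close> contains
        \<open>sigma0^2\<close> twice, hence \<open>2 * B + 1\<close>.\<close>
      have pb: "L * exp (- ((2 * B + 1) * H)) \<le> pb"
      proof -
        have "exp (- (B * H)) \<le> exp (- (B * ln (real n)))"
          using Hln assms by simp
        also have "\<dots> \<le> (sigma0 n)\<^sup>2" using s0B n by (simp add: powr_def)
        finally have 1: "exp (- (B * H)) \<le> (sigma0 n)\<^sup>2" .
        have "exp (- H) \<le> exp (- ln (real n))" using Hln by simp
        also have "\<dots> = 1 / real n" using n by (simp add: exp_minus inverse_eq_divide)
        also have "\<dots> \<le> H / real n" using H1 by (intro divide_right_mono) auto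
        also have "\<dots> = \<delta>\<^sup>2" using n by (simp add: H_def)
        finally have 2: "exp (- H) \<le> \<delta>\<^sup>2" .
        have "exp (- ((2 * B + 1) * H)) = exp (- (B * H)) * exp (- (B * H)) * exp (- H)"
          unfolding exp_add[symmetric] by (simp add: algebra_simps)
        also have "\<dots> \<le> (sigma0 n)\<^sup>2 * (sigma0 n)\<^sup>2 * \<delta>\<^sup>2"
          using 1 2 by (intro mult_mono) auto
        finally have "L * exp (- ((2 * B + 1) * H)) \<le> L * ((sigma0 n)\<^sup>2 * (sigma0 n)\<^sup>2 * \<delta>\<^sup>2)"
          using L by (intro mult_left_mono) auto
        also have "\<dots> = pb" by (simp add: pb_def power2_eq_square)
        finally show ?thesis .
      qed
      have K\<delta>: "K * \<delta> \<le> 1 / 2" using small1 K unfolding \<delta>_def[symmetric] by (simp add: field_simps)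
      have M1\<delta>: "64 * M1\<^sup>2 * \<delta> \<le> K"
      proof -
        have "64 * M1\<^sup>2 > 0" using M1(1) by simp
        then show ?thesis using small2 unfolding \<delta>_def[symmetric] by (simp add: field_simps)
      qed
      have pa: "exp (- (Cbar * H)) \<le> measure (Pmu n) {mu \<in> space (Pmu n). l2norm_sq n (\<lambda>i. mu i - mu0 n i)
          \<le> real n * (sigma0 n * \<delta>)\<^sup>2}"
        using mass[rule_format, OF n, unfolded Hx] by (simp add: e[symmetric])
      have pc: "measure (Pmu n) (space (Pmu n) - Mset n) \<le> exp (- (Ebar * H))"
        using sieve[rule_format, OF n, unfolded Hx] by simp
      have "post n \<le> 2 * exp (- (K\<^sup>2 * H / 16)) + real (card F) * exp (- (M1\<^sup>2 * H / 8)) + exp (- H)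
        + exp (5 / 2 * H) / (exp (- (Cbar * H)) * pb) * (exp (- (Ebar * H)) + exp (- (E * H)))"
        unfolding post_def e
        by (rule posterior_contraction_bound[OF n s0 \<delta> _ _ Q gm K(1) K\<delta> _ M1(1) _ M1\<delta> M _ F(1) _ _ pa pb0 pbQ pc H_def])
           (use Pmu sieve n F(2) K(2) M1(2) Dbar in \<open>auto simp: e[symmetric]\<close>)
      also have "\<dots> \<le> 2 * exp (- H) + 2 * exp (- H) + exp (- H) + 2 / L * exp (- H)"
      proof (intro add_mono)
        show "2 * exp (- (K\<^sup>2 * H / 16)) \<le> 2 * exp (- H)"
          using mult_right_mono[of 1 "K\<^sup>2 / 16" H] K(2) E5 H1 by simp
        \<comment> \<open>This absorbs the additive 1 from extracting a finite cover.\<close>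
        have "1 \<le> exp (Dbar * H)" using Dbar H1 by simp
        then have "real (card F) \<le> 2 * exp (Dbar * H)" using F(3) by linarith
        then have "real (card F) * exp (- (M1\<^sup>2 * H / 8)) \<le> 2 * exp (Dbar * H) * exp (- (M1\<^sup>2 * H / 8))"
          by (intro mult_right_mono) auto
        also have "\<dots> = 2 * exp (Dbar * H + - (M1\<^sup>2 * H / 8))" by (simp only: exp_add mult.assoc)
        also have "\<dots> \<le> 2 * exp (- H)"
        proof -
          have "(Dbar + 1) * H \<le> M1\<^sup>2 / 8 * H" using M1(2) E5 H1 by (intro mult_right_mono) auto
          then show ?thesis by (simp add: algebra_simps)
        qed
        finally show "real (card F) * exp (- (M1\<^sup>2 * H / 8)) \<le> 2 * exp (- H)" .
        have "exp (- (Ebar * H)) \<le> exp (- (E * H))" using Ebar H1 by (simp add: mult_right_mono)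
        then have sum: "exp (- (Ebar * H)) + exp (- (E * H)) \<le> 2 * exp (- (E * H))" by simp
        have "exp (5 / 2 * H) / (exp (- (Cbar * H)) * pb)
          \<le> exp (5 / 2 * H) / (exp (- (Cbar * H)) * (L * exp (- ((2 * B + 1) * H))))"
          using pb pb0 L by (intro divide_left_mono mult_left_mono mult_pos_pos) auto
        also have "\<dots> = exp (5 / 2 * H + Cbar * H + (2 * B + 1) * H) / L"
          unfolding exp_add by (simp add: exp_minus divide_simps)
        finally have "exp (5 / 2 * H) / (exp (- (Cbar * H)) * pb) * (exp (- (Ebar * H)) + exp (- (E * H)))
          \<le> exp (5 / 2 * H + Cbar * H + (2 * B + 1) * H) / L * (2 * exp (- (E * H)))"
          using sum L by (intro mult_mono) auto
        also have "\<dots> = 2 / L * exp (5 / 2 * H + Cbar * H + (2 * B + 1) * H + - (E * H))"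
          unfolding exp_add[of _ "- (E * H)"] by (simp add: mult_ac)
        also have "5 / 2 * H + Cbar * H + (2 * B + 1) * H + - (E * H) = - (3 / 2 * H)"
          by (simp add: E_def algebra_simps)
        also have "2 / L * exp (- (3 / 2 * H)) \<le> 2 / L * exp (- H)"
          using L H1 by (intro mult_left_mono) auto
        finally show "exp (5 / 2 * H) / (exp (- (Cbar * H)) * pb) * (exp (- (Ebar * H)) + exp (- (E * H)))
          \<le> 2 / L * exp (- H)" .
      qed simp
      also have "\<dots> = (5 + 2 / L) * exp (- H)" by (simp add: algebra_simps)
      also have "\<dots> \<le> (5 + 2 / L) * exp (- ln (real n))"
        using L Hln by (intro mult_left_mono) auto
      also have "exp (- ln (real n)) = inverse (real n)" using n by (simp add: exp_minus)
      finally show ?thesis .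
    qed
    have "post \<longlonglongrightarrow> 0"
    proof (rule tendsto_sandwich[OF _ _ tendsto_const])
      show "\<forall>\<^sub>F n in sequentially. 0 \<le> post n"
        unfolding post_def by (intro always_eventually allI integral_nonneg_AE AE_I2 posterior_prob_nonneg)
      have "0 < 1 / (2 * K)" using K by simp
      then have ev1: "\<forall>\<^sub>F n in sequentially. eps n / sigma0 n < 1 / (2 * K)"
        using lim by (rule order_tendstoD(2)[rotated])
      have "0 < K / (64 * M1\<^sup>2)" using K M1 by simp
      then have ev2: "\<forall>\<^sub>F n in sequentially. eps n / sigma0 n < K / (64 * M1\<^sup>2)"
        using lim by (rule order_tendstoD(2)[rotated])
      show "\<forall>\<^sub>F n in sequentially. post n \<le> (5 + 2 / L) * inverse (real n)"
        using ev1 ev2 eventually_ge_at_top[of "3::nat"]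
        by eventually_elim (rule bound)
      show "(\<lambda>n. (5 + 2 / L) * inverse (real n)) \<longlonglongrightarrow> 0"
        by (rule tendsto_mult_right_zero[OF lim_inverse_n])
    qed
    then show "\<exists>M>0. (\<lambda>n. \<integral>y. posterior_prob n (joint_prior (Pmu n) g)
          (\<lambda>mu sd. dpar n (mu, sd) (mu0 n, sigma0 n) \<ge> M * eps n) y
        \<partial>gauss_measure n (mu0 n) (sigma0 n)) \<longlonglongrightarrow> 0"
      using M0 unfolding post_def by blast
  qed
qed

end
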